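(* If $I_L$ is an $L_\beta$-homogeneous lattice ideal of (Krull) dimension $d=r-n$, then its degree is $\deg(I_L)=|L_\beta/L|=d_1\cdots d_n$, where $d_1,\dots,d_n$ are the invariant factors of $L_\beta/L$.
   Context: $\mathbb K$ is a field. $\Sigma$ is a complete simplicial fan in $\mathbb R^n$ with rays $\rho_1,\dots,\rho_r$ generated by primitive lattice vectors $\mathbf v_1,\dots,\mathbf v_r\in\mathbb Z^n$, such that the corresponding $n$-dimensional split toric variety $X=X_\Sigma$ over $\mathbb K$ is smooth and projective; its class group $\operatorname{Cl}X$ is free. Let $\phi:\mathbb Z^n\to\mathbb Z^r$ be the $r\times n$ matrix with rows $\mathbf v_1,\dots,\mathbf v_r$, let $d=r-n$, and let $\beta:\mathbb Z^r\to\mathbb Z^d\cong \operatorname{Cl}X$ be an integer matrix such that $0\to\mathbb Z^n\xrightarrow{\phi}\mathbb Z^r\xrightarrow{\beta}\mathbb Z^d\to0$ is exact. $L_\beta=\operatorname{im}\phi=\ker\beta\subseteq\mathbb Z^r$, a lattice of rank $n$. The Cox ring $S=\mathbb K[x_1,\dots,x_r]$ is graded by $\deg x_j=\beta_j$, the $j$-th column of $\beta$; "$L_\beta$-homogeneous" means homogeneous for this grading. For a lattice $L\subseteq\mathbb Z^r$, the lattice ideal is $I_L=\langle \mathbf x^{\mathbf m^+}-\mathbf x^{\mathbf m^-} : \mathbf m=\mathbf m^+-\mathbf m^-\in L\rangle\subseteq S$, where $\mathbf m^{\pm}\in\mathbb N^r$ are the positive and negative parts of $\mathbf m$. $I_L$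 is $L_\beta$-homogeneous if and only if $L\subseteq L_\beta$. The dimension of $I_L$ is the Krull dimension of $S/I_L$. Degree: for a graded $S$-module $M$, $H_M(\alpha)=\dim_{\mathbb K}M_\alpha$, and the multigraded Hilbert polynomial of $M$ (Maclagan–Smith) is the polynomial $P_M\in\mathbb Q[t_1,\dots,t_d]$ with $P_M(\alpha)=H_M(\alpha)$ for all $\alpha$ sufficiently far inside the semigroup $\mathcal K=\bigcap_{\sigma\in\Sigma}\mathbb N\{\beta_i:\rho_i\not\subseteq\sigma\}$ of nef degrees (i.e. for all $\alpha$ in some translate of $\mathcal K$). The degree $\deg(I)$ of an ideal $I$ for which $P_{S/I}$ is constant is that constant; in particular this applies to $B$-saturated homogeneous ideals of finite sets of points, where $B$ is generated by the monomials $\prod_{\rho_i\not\subseteq\sigma}x_i$, $\sigma\in\Sigma$. Invariant factors of $L_\beta/L$: the positive integers $d_1\mid d_2\mid\cdots\mid d_n$ (the value $1$ allowed) such that $L_\beta$ has a basis $\mathbf m_1,\dots,\mathbf m_n$ with $d_1\mathbf m_1,\dots,d_n\mathbf m_n$ a basis of $L$. *)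

theory Defs
  imports
    "HOL-Analysis.Analysis"
    "HOL-Library.Poly_Mapping"
    "HOL-Algebra.QuotRing"
    "HOL-Algebra.Embedded_Algebras"
    "HOL-Algebra.Algebraic_Closure_Type"
begin

section \<open>Lattices\<close>

definition sublattice :: "(int ^ 'm) set \<Rightarrow> bool" where
  "sublattice L \<longleftrightarrow> 0 \<in> L \<and> (\<forall>x\<in>L. \<forall>y\<in>L. x - y \<in> L)"

text \<open>The family \<open>b\<close>, indexed by the finite set \<open>J\<close>, is a basis over the integers of \<open>M\<close>.\<close>

definition int_basis :: "'i set \<Rightarrow> ('i \<Rightarrow> int ^ 'm) \<Rightarrow> (int ^ 'm) set \<Rightarrow> bool" where
  "int_basis J b M \<longleftrightarrow> bij_betw (\<lambda>c. \<Sum>i\<in>J. c i *s b i) (J \<rightarrow>\<^sub>E UNIV) M"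

definition quotient_group :: "(int ^ 'm) set \<Rightarrow> (int ^ 'm) set \<Rightarrow> (int ^ 'm) set set" where
  "quotient_group M L = M // {(x, y). x \<in> M \<and> y \<in> M \<and> x - y \<in> L}"

text \<open>\<open>d 1, \<dots>, d n\<close> are the invariant factors of \<open>M / L\<close>; the values \<open>d i\<close> for other
  indices are irrelevant.\<close>

definition invariant_factors ::
    "nat \<Rightarrow> (nat \<Rightarrow> nat) \<Rightarrow> (int ^ 'm) set \<Rightarrow> (int ^ 'm) set \<Rightarrow> bool" where
  "invariant_factors n d M L \<longleftrightarrow>
     (\<forall>i\<in>{1..n}. 0 < d i) \<and>
     (\<forall>i\<in>{1..<n}. d i dvd d (Suc i)) \<and>
     (\<exists>m. int_basis {1..n} m M \<and> int_basis {1..n} (\<lambda>i. int (d i) *s m i) L)"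

section \<open>Fans\<close>

definition real_vec :: "int ^ 'n \<Rightarrow> real ^ 'n" where
  "real_vec u = (\<chi> i. real_of_int (u $ i))"

definition rational_polyhedral_cone :: "(real ^ 'n) set \<Rightarrow> bool" where
  "rational_polyhedral_cone \<sigma> \<longleftrightarrow> (\<exists>G. finite G \<and> \<sigma> = convex_cone hull (real_vec ` G))"

definition strongly_convex :: "(real ^ 'n) set \<Rightarrow> bool" where
  "strongly_convex \<sigma> \<longleftrightarrow> \<sigma> \<inter> uminus ` \<sigma> = {0}"

text \<open>The predicate \<open>face_of\<close> also admits the empty face, which is not a face of a cone.\<close>

definition fan :: "(real ^ 'n) set set \<Rightarrow> bool" where
  "fan \<Sigma> \<longleftrightarrow>
     finite \<Sigma> \<and>
     (\<forall>\<sigma>\<in>\<Sigma>. rational_polyhedral_cone \<sigma> \<and> strongly_convex \<sigma>) \<and>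
     (\<forall>\<sigma>\<in>\<Sigma>. \<forall>\<tau>. \<tau> face_of \<sigma> \<and> \<tau> \<noteq> {} \<longrightarrow> \<tau> \<in> \<Sigma>) \<and>
     (\<forall>\<sigma>\<in>\<Sigma>. \<forall>\<tau>\<in>\<Sigma>. (\<sigma> \<inter> \<tau>) face_of \<sigma> \<and> (\<sigma> \<inter> \<tau>) face_of \<tau>)"

definition complete_fan :: "(real ^ 'n) set set \<Rightarrow> bool" where
  "complete_fan \<Sigma> \<longleftrightarrow> fan \<Sigma> \<and> \<Union>\<Sigma> = UNIV"

definition simplicial_fan :: "(real ^ 'n) set set \<Rightarrow> bool" where
  "simplicial_fan \<Sigma> \<longleftrightarrow>
     fan \<Sigma> \<and> (\<forall>\<sigma>\<in>\<Sigma>. \<exists>G. independent G \<and> \<sigma> = convex_cone hull G)"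

text \<open>The split toric variety of \<open>\<Sigma>\<close> (over any field) is smooth iff every cone is generated
  by part of a basis of the lattice of integral points.\<close>

definition smooth_fan :: "(real ^ 'n) set set \<Rightarrow> bool" where
  "smooth_fan \<Sigma> \<longleftrightarrow>
     fan \<Sigma> \<and>
     (\<forall>\<sigma>\<in>\<Sigma>. \<exists>(b :: 'n \<Rightarrow> int ^ 'n) J.
        int_basis UNIV b UNIV \<and> \<sigma> = convex_cone hull (real_vec ` b ` J))"

text \<open>Inner normal cone of the polytope \<open>P\<close> along its face \<open>F\<close>. The split toric variety of
  \<open>\<Sigma>\<close> is projective iff \<open>\<Sigma>\<close> is the normal fan of a full-dimensional lattice polytope.\<close>

definition normal_cone :: "(real ^ 'n) set \<Rightarrow> (real ^ 'n) set \<Rightarrow> (real ^ 'n) set" where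
  "normal_cone P F = {u. \<forall>m\<in>F. \<forall>m'\<in>P. u \<bullet> m \<le> u \<bullet> m'}"

definition projective_fan :: "(real ^ 'n) set set \<Rightarrow> bool" where
  "projective_fan \<Sigma> \<longleftrightarrow>
     fan \<Sigma> \<and>
     (\<exists>V P. finite V \<and> P = convex hull (real_vec ` V) \<and> aff_dim P = int CARD('n) \<and>
        \<Sigma> = {normal_cone P F | F. F face_of P \<and> F \<noteq> {}})"

definition ray :: "int ^ 'n \<Rightarrow> (real ^ 'n) set" where
  "ray u = convex_cone hull {real_vec u}"

definition primitive_vec :: "int ^ 'n \<Rightarrow> bool" where
  "primitive_vec u \<longleftrightarrow> Gcd (range (\<lambda>j. u $ j)) = 1"

definition ray_generators :: "('r \<Rightarrow> int ^ 'n) \<Rightarrow> (real ^ 'n) set set \<Rightarrow> bool" where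
  "ray_generators v \<Sigma> \<longleftrightarrow>
     (\<forall>i. primitive_vec (v i)) \<and>
     bij_betw (\<lambda>i. ray (v i)) UNIV {\<rho>\<in>\<Sigma>. aff_dim \<rho> = 1}"

section \<open>The grading by the class group\<close>

text \<open>Exactness of \<open>0 \<rightarrow> \<int>\<^sup>n \<rightarrow> \<int>\<^sup>r \<rightarrow> \<int>\<^sup>d \<rightarrow> 0\<close>, where the first map is the matrix
  with rows \<open>v i\<close>.\<close>

definition ray_matrix :: "('r \<Rightarrow> int ^ 'n) \<Rightarrow> int ^ 'n ^ 'r" where
  "ray_matrix v = (\<chi> i. v i)"

definition kernel_lattice :: "int ^ 'r ^ 'd \<Rightarrow> (int ^ 'r) set" where
  "kernel_lattice \<beta> = {u. \<beta> *v u = 0}"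

definition short_exact :: "int ^ 'n ^ 'r \<Rightarrow> int ^ 'r ^ 'd \<Rightarrow> bool" where
  "short_exact \<phi> \<beta> \<longleftrightarrow>
     inj (\<lambda>m. \<phi> *v m) \<and> range (\<lambda>m. \<phi> *v m) = kernel_lattice \<beta> \<and> surj (\<lambda>u. \<beta> *v u)"

text \<open>The semigroup of nef degrees.\<close>

definition nef_semigroup ::
    "('r \<Rightarrow> int ^ 'n) \<Rightarrow> (real ^ 'n) set set \<Rightarrow> int ^ 'r ^ 'd \<Rightarrow> (int ^ 'd) set" where
  "nef_semigroup v \<Sigma> \<beta> =
     (\<Inter>\<sigma>\<in>\<Sigma>. {\<Sum>i | \<not> ray (v i) \<subseteq> \<sigma>. int (c i) *s column i \<beta> | c :: 'r \<Rightarrow> nat. True})"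

section \<open>The Cox ring and lattice ideals\<close>

type_synonym ('x, 'a) mpoly = "('x \<Rightarrow>\<^sub>0 nat) \<Rightarrow>\<^sub>0 'a"

definition cox_ring :: "('r, 'k::field) mpoly ring" where
  "cox_ring = ring_of_type_algebra"

definition monomial_degree :: "int ^ 'r ^ 'd \<Rightarrow> ('r \<Rightarrow>\<^sub>0 nat) \<Rightarrow> int ^ 'd" where
  "monomial_degree \<beta> u = (\<Sum>j\<in>UNIV. int (Poly_Mapping.lookup u j) *s column j \<beta>)"

definition graded_piece :: "int ^ 'r ^ 'd \<Rightarrow> int ^ 'd \<Rightarrow> ('r, 'k::field) mpoly set" where
  "graded_piece \<beta> \<alpha> = {f. \<forall>u\<in>Poly_Mapping.keys f. monomial_degree \<beta> u = \<alpha>}"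

definition homogeneous_component ::
    "int ^ 'r ^ 'd \<Rightarrow> int ^ 'd \<Rightarrow> ('r, 'k::field) mpoly \<Rightarrow> ('r, 'k) mpoly" where
  "homogeneous_component \<beta> \<alpha> f =
     (\<Sum>u | u \<in> Poly_Mapping.keys f \<and> monomial_degree \<beta> u = \<alpha>. Poly_Mapping.single u (Poly_Mapping.lookup f u))"

definition homogeneous_ideal :: "int ^ 'r ^ 'd \<Rightarrow> ('r, 'k::field) mpoly set \<Rightarrow> bool" where
  "homogeneous_ideal \<beta> I \<longleftrightarrow>
     ideal I cox_ring \<and> (\<forall>f\<in>I. \<forall>\<alpha>. homogeneous_component \<beta> \<alpha> f \<in> I)"

text \<open>For \<open>m\<close> in \<open>\<int>\<^sup>r\<close> this is the monomial with exponent vector the positive part of \<open>m\<close>.\<close>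

definition pos_monomial :: "int ^ 'r \<Rightarrow> ('r::finite, 'k::field) mpoly" where
  "pos_monomial m = Poly_Mapping.single (Abs_poly_mapping (\<lambda>i. nat (m $ i))) 1"

definition lattice_ideal :: "(int ^ 'r) set \<Rightarrow> ('r::finite, 'k::field) mpoly set" where
  "lattice_ideal L = Idl\<^bsub>cox_ring\<^esub> {pos_monomial m - pos_monomial (- m) | m. m \<in> L}"

text \<open>Supremum of the lengths of chains of prime ideals (0 for the zero ring).\<close>

definition krull_dim :: "('a, 'b) ring_scheme \<Rightarrow> enat" where
  "krull_dim R =
     (SUP n \<in> {n. \<exists>p :: nat \<Rightarrow> 'a set.
        (\<forall>i\<le>n. primeideal (p i) R) \<and> (\<forall>i<n. p i \<subset> p (Suc i))}. enat n)"

section \<open>Multigraded Hilbert polynomial and degree\<close>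

text \<open>The dimension of the image in \<open>S / I\<close> of the degree \<open>\<alpha>\<close> piece of \<open>S\<close>, over the field of
  residue classes of constants.\<close>

definition hilbert_function ::
    "int ^ 'r ^ 'd \<Rightarrow> ('r, 'k::field) mpoly set \<Rightarrow> int ^ 'd \<Rightarrow> nat" where
  "hilbert_function \<beta> I \<alpha> =
     ring.dim (cox_ring Quot I)
       (range (\<lambda>c. I +>\<^bsub>cox_ring\<^esub> Poly_Mapping.single 0 c))
       ((\<lambda>f. I +>\<^bsub>cox_ring\<^esub> f) ` graded_piece \<beta> \<alpha>)"

definition eval_mpoly :: "('d::finite, rat) mpoly \<Rightarrow> int ^ 'd \<Rightarrow> rat" where
  "eval_mpoly P \<alpha> = (\<Sum>u\<in>Poly_Mapping.keys P. Poly_Mapping.lookup P u * (\<Prod>i\<in>UNIV. of_int (\<alpha> $ i) ^ Poly_Mapping.lookup u i))"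

definition is_hilbert_polynomial ::
    "('r \<Rightarrow> int ^ 'n) \<Rightarrow> (real ^ 'n) set set \<Rightarrow> int ^ 'r ^ 'd \<Rightarrow> ('r, 'k::field) mpoly set \<Rightarrow>
      ('d::finite, rat) mpoly \<Rightarrow> bool" where
  "is_hilbert_polynomial v \<Sigma> \<beta> I P \<longleftrightarrow>
     (\<exists>\<gamma>. \<forall>\<alpha>\<in>nef_semigroup v \<Sigma> \<beta>.
        eval_mpoly P (\<gamma> + \<alpha>) = of_nat (hilbert_function \<beta> I (\<gamma> + \<alpha>)))"

definition hilbert_polynomial ::
    "('r \<Rightarrow> int ^ 'n) \<Rightarrow> (real ^ 'n) set set \<Rightarrow> int ^ 'r ^ 'd \<Rightarrow> ('r, 'k::field) mpoly set \<Rightarrow>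
      ('d::finite, rat) mpoly" where
  "hilbert_polynomial v \<Sigma> \<beta> I = (THE P. is_hilbert_polynomial v \<Sigma> \<beta> I P)"

text \<open>Meaningful only if the Hilbert polynomial exists, is unique and is constant.\<close>

definition ideal_degree ::
    "('r \<Rightarrow> int ^ 'n) \<Rightarrow> (real ^ 'n) set set \<Rightarrow> int ^ 'r ^ 'd::finite \<Rightarrow>
      ('r, 'k::field) mpoly set \<Rightarrow> rat" where
  "ideal_degree v \<Sigma> \<beta> I = (THE c. hilbert_polynomial v \<Sigma> \<beta> I = Poly_Mapping.single 0 c)"

end

theory Submission
  imports Defs "HOL-Library.Set_Algebras"
begin

text \<open>
  Write \<open>M\<close> for the kernel lattice of \<open>\<beta>\<close>. The quotient of the Cox ring by the lattice ideal of \<open>L\<close> is the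
  subalgebra of the group algebra of \<open>\<int>\<^sup>r / L\<close> spanned by the cosets of nonnegative vectors. Its piece of degree \<open>\<alpha>\<close> therefore
  has as dimension the number of cosets of \<open>L\<close> inside the fibre of \<open>\<beta>\<close> over \<open>\<alpha>\<close> that contain a
  nonnegative vector (\<open>hilbert_function_lattice_ideal\<close>). The fibre is a translate of \<open>M\<close>, so at most
  \<open>|M / L|\<close> cosets are available, and if this number is finite all of them contain a nonnegative vector
  once \<open>\<alpha>\<close> is deep enough (\<open>hilbert_function_eventually_index\<close>). The Hilbert polynomial is thus the
  constant \<open>|M / L|\<close>, independently of the field.

  Finiteness of \<open>M / L\<close> comes from the Krull dimension. If some vector of \<open>M\<close> had infinite order modulo
  \<open>L\<close>, then \<open>L\<close> would have rank less than \<open>n\<close>, and a flag of saturated lattices from the saturation of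
  \<open>L\<close> up to \<open>\<int>\<^sup>r\<close> would give a chain of more than \<open>d + 1\<close> prime ideals above the lattice ideal
  (\<open>torsion_of_krull_dim\<close>). They are prime because the group algebra of a torsion-free quotient of
  \<open>\<int>\<^sup>r\<close>, which embeds into an ordered group, has no zero divisors. With \<open>M / L\<close> torsion, \<open>stacked_bases\<close> provides
  invariant factors, and \<open>card_quotient_group\<close> identifies their product with the number of cosets.

  That the Hilbert polynomial is unique needs the nef semigroup to be full-dimensional, and this is
  where the geometry of the fan enters: a lattice polytope with normal fan \<open>\<Sigma>\<close> yields a class \<open>a\<close> such that for
  every \<open>e\<close> the degree \<open>k a + e\<close> is nef for all large \<open>k\<close> (\<open>ample_class\<close>). Smoothness is used to represent
  every class by a divisor that avoids a given affine chart.
\<close>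

section \<open>Changing exponents in monoid algebras\<close>

text \<open>The \<open>k\<close>-linear map between monoid algebras that replaces the exponent \<open>u\<close> by \<open>\<theta> u\<close>. For additive
  \<open>\<theta>\<close> it is multiplicative. What lies outside an ideal is detected below by such maps: with \<open>\<theta>\<close> the passage to cosets of a lattice its kernel contains the lattice ideal,
  and with values of \<open>\<theta>\<close> in an ordered group its kernel is prime.\<close>

definition map_exponents :: "('a \<Rightarrow> 'b) \<Rightarrow> ('a \<Rightarrow>\<^sub>0 'k) \<Rightarrow> ('b \<Rightarrow>\<^sub>0 'k::comm_monoid_add)" where
  "map_exponents \<theta> f = (\<Sum>u\<in>Poly_Mapping.keys f. Poly_Mapping.single (\<theta> u) (Poly_Mapping.lookup f u))"

lemma map_exponents_superset:
  assumes "finite A" "Poly_Mapping.keys f \<subseteq> A"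
  shows "map_exponents \<theta> f = (\<Sum>u\<in>A. Poly_Mapping.single (\<theta> u) (Poly_Mapping.lookup f u))"
  unfolding map_exponents_def
  using assms by (intro sum.mono_neutral_left) (auto simp: in_keys_iff)

lemma map_exponents_single [simp]:
  "map_exponents \<theta> (Poly_Mapping.single u c) = Poly_Mapping.single (\<theta> u) c"
  by (simp add: map_exponents_def)

lemma map_exponents_zero [simp]: "map_exponents \<theta> 0 = 0"
  by (simp add: map_exponents_def)

lemma map_exponents_add:
  "map_exponents \<theta> (f + g) = map_exponents \<theta> f + map_exponents \<theta> g"
proof -
  let ?A = "Poly_Mapping.keys f \<union> Poly_Mapping.keys g"
  have "map_exponents \<theta> h = (\<Sum>u\<in>?A. Poly_Mapping.single (\<theta> u) (Poly_Mapping.lookup h u))"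
    if "h \<in> {f, g, f + g}" for h
    using that keys_add[of f g] by (intro map_exponents_superset) auto
  thus ?thesis
    by (simp add: lookup_add single_add sum.distrib)
qed

lemma map_exponents_sum:
  "map_exponents \<theta> (\<Sum>i\<in>A. f i) = (\<Sum>i\<in>A. map_exponents \<theta> (f i))"
  by (induction A rule: infinite_finite_induct) (simp_all add: map_exponents_add)

lemma map_exponents_diff:
  fixes f g :: "'a \<Rightarrow>\<^sub>0 'k::ab_group_add"
  shows "map_exponents \<theta> (f - g) = map_exponents \<theta> f - map_exponents \<theta> g"
  using map_exponents_add[of \<theta> "f - g" g] by simp

lemma map_exponents_id [simp]: "map_exponents (\<lambda>u. u) f = f"
proof (rule poly_mapping_eqI)
  fix k
  show "Poly_Mapping.lookup (map_exponents (\<lambda>u. u) f) k = Poly_Mapping.lookup f k"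
    by (auto simp: map_exponents_def lookup_sum lookup_single when_def in_keys_iff)
qed

lemma sum_of_monomials: "f = (\<Sum>u\<in>Poly_Mapping.keys f. Poly_Mapping.single u (Poly_Mapping.lookup f u))"
  using map_exponents_id[of f] unfolding map_exponents_def by (rule sym)

lemma map_exponents_comp:
  "map_exponents \<theta> (map_exponents \<eta> f) = map_exponents (\<lambda>u. \<theta> (\<eta> u)) f"
  by (simp add: map_exponents_def[of _ f] map_exponents_sum)

text \<open>Stated for semigroup homomorphisms \<open>\<theta>\<close>, since the coset map sends the exponent \<open>0\<close> to the
  lattice itself, which is not the neutral element of the monoid of all sets of vectors.\<close>

lemma map_exponents_mult:
  fixes \<theta> :: "'a::comm_monoid_add \<Rightarrow> 'b::comm_monoid_add" and f g :: "'a \<Rightarrow>\<^sub>0 'k::comm_ring_1"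
  assumes "\<And>u w. \<theta> (u + w) = \<theta> u + \<theta> w"
  shows "map_exponents \<theta> (f * g) = map_exponents \<theta> f * map_exponents \<theta> g"
proof -
  have "f * g = (\<Sum>u\<in>Poly_Mapping.keys f. \<Sum>w\<in>Poly_Mapping.keys g.
      Poly_Mapping.single (u + w) (Poly_Mapping.lookup f u * Poly_Mapping.lookup g w))"
    by (subst sum_of_monomials[of f], subst sum_of_monomials[of g]) (simp add: sum_product mult_single)
  thus ?thesis
    by (simp add: map_exponents_sum assms) (simp add: map_exponents_def sum_product mult_single)
qed

section \<open>The Cox ring and its quotients\<close>

lemma cox_ring_simps [simp]:
  "carrier cox_ring = UNIV" "mult cox_ring = (*)" "one cox_ring = 1"
  "zero cox_ring = 0" "add cox_ring = (+)"
  by (simp_all add: cox_ring_def ring_of_type_algebra_def fun_eq_iff)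

lemma cring_cox_ring: "cring (cox_ring :: ('r, 'k::field) mpoly ring)"
  unfolding cox_ring_def by (rule cring_from_type_algebra)

text \<open>Closure under negation comes from multiplication by \<open>- 1\<close>.\<close>

lemma ideal_cox_ringI:
  fixes J :: "('r, 'k::field) mpoly set"
  assumes "0 \<in> J" "\<And>f g. f \<in> J \<Longrightarrow> g \<in> J \<Longrightarrow> f + g \<in> J" "\<And>f g. f \<in> J \<Longrightarrow> g * f \<in> J"
  shows "ideal J cox_ring"
proof -
  interpret cring "cox_ring :: ('r, 'k) mpoly ring" by (rule cring_cox_ring)
  have r: "f * g \<in> J" if "f \<in> J" for f g
    using assms(3)[OF that, of g] by (simp add: mult.commute)
  have m: "- f \<in> J" if "f \<in> J" for f
    using assms(3)[OF that, of "- 1"] by simp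
  have inv: "inv\<^bsub>add_monoid cox_ring\<^esub> f = - f" for f :: "('r, 'k) mpoly"
    using minus_equality[of "- f" f] by (simp add: a_inv_def)
  show ?thesis
  proof (rule idealI)
    show "ring (cox_ring :: ('r, 'k) mpoly ring)" by (rule ring_axioms)
    show "subgroup J (add_monoid cox_ring)"
    proof (rule add.subgroupI)
      show "\<ominus>\<^bsub>cox_ring\<^esub> f \<in> J" if "f \<in> J" for f
        unfolding a_inv_def inv by (rule m[OF that])
    qed (use assms in auto)
  qed (auto simp: assms r)
qed

lemma ideal_cox_ring_add: "ideal J cox_ring \<Longrightarrow> f \<in> J \<Longrightarrow> g \<in> J \<Longrightarrow> f + g \<in> J"
  using additive_subgroup.a_closed[OF ideal.axioms(1), of J cox_ring f g] by simp

lemma ideal_cox_ring_mult: "ideal J cox_ring \<Longrightarrow> f \<in> J \<Longrightarrow> g * f \<in> J"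
  using ideal.I_l_closed[of J cox_ring f g] by simp

lemma ideal_cox_ring_zero: "ideal J cox_ring \<Longrightarrow> 0 \<in> J"
  using additive_subgroup.zero_closed[OF ideal.axioms(1), of J cox_ring] by simp

lemma ideal_cox_ring_diff:
  assumes "ideal J cox_ring" "f \<in> J" "g \<in> J"
  shows "f - g \<in> J"
  using ideal_cox_ring_add[OF assms(1,2) ideal_cox_ring_mult[OF assms(1,3), of "- 1"]] by simp

lemma ideal_cox_ring_sum:
  assumes "ideal J cox_ring" "\<And>i. i \<in> A \<Longrightarrow> f i \<in> J"
  shows "(\<Sum>i\<in>A. f i) \<in> J"
  using assms(2)
  by (induction A rule: infinite_finite_induct)
    (auto intro: ideal_cox_ring_add ideal_cox_ring_zero assms(1))

lemma coset_eq_iff: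
  assumes "ideal J cox_ring"
  shows "J +>\<^bsub>cox_ring\<^esub> f = J +>\<^bsub>cox_ring\<^esub> g \<longleftrightarrow> f - g \<in> J"
proof
  have *: "J +>\<^bsub>cox_ring\<^esub> f = {j + f | j. j \<in> J}" for f
    by (auto simp: a_r_coset_def')
  show "f - g \<in> J" if "J +>\<^bsub>cox_ring\<^esub> f = J +>\<^bsub>cox_ring\<^esub> g"
  proof -
    have "f \<in> {j + f | j. j \<in> J}" using ideal_cox_ring_zero[OF assms] by force
    hence "f \<in> {j + g | j. j \<in> J}" using that unfolding * by simp
    then obtain j where "f = j + g" "j \<in> J" by blast
    thus ?thesis by simp
  qed
  show "J +>\<^bsub>cox_ring\<^esub> f = J +>\<^bsub>cox_ring\<^esub> g" if *: "f - g \<in> J"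
  proof -
    have "\<exists>j'. j + f = j' + g \<and> j' \<in> J" if "j \<in> J" for j
      using ideal_cox_ring_add[OF assms that *] by (intro exI[of _ "j + (f - g)"]) auto
    moreover have "\<exists>j'. j + g = j' + f \<and> j' \<in> J" if "j \<in> J" for j
      using ideal_cox_ring_diff[OF assms that *] by (intro exI[of _ "j - (f - g)"]) auto
    ultimately show ?thesis by (auto simp: a_r_coset_def')
  qed
qed

lemma quotient_simps:
  assumes "ideal J cox_ring"
  shows "carrier (cox_ring Quot J) = range (\<lambda>f. J +>\<^bsub>cox_ring\<^esub> f)"
    "(J +>\<^bsub>cox_ring\<^esub> f) \<otimes>\<^bsub>cox_ring Quot J\<^esub> (J +>\<^bsub>cox_ring\<^esub> g) = J +>\<^bsub>cox_ring\<^esub> (f * g)"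
    "(J +>\<^bsub>cox_ring\<^esub> f) \<oplus>\<^bsub>cox_ring Quot J\<^esub> (J +>\<^bsub>cox_ring\<^esub> g) = J +>\<^bsub>cox_ring\<^esub> (f + g)"
    "\<one>\<^bsub>cox_ring Quot J\<^esub> = J +>\<^bsub>cox_ring\<^esub> 1"
    "\<zero>\<^bsub>cox_ring Quot J\<^esub> = J +>\<^bsub>cox_ring\<^esub> 0"
proof -
  interpret ideal J cox_ring by fact
  interpret h: ring_hom_ring cox_ring "cox_ring Quot J" "\<lambda>f. J +>\<^bsub>cox_ring\<^esub> f"
    by (rule rcos_ring_hom_ring)
  show "carrier (cox_ring Quot J) = range (\<lambda>f. J +>\<^bsub>cox_ring\<^esub> f)"
    by (auto simp: FactRing_def A_RCOSETS_def')
  show "(J +>\<^bsub>cox_ring\<^esub> f) \<otimes>\<^bsub>cox_ring Quot J\<^esub> (J +>\<^bsub>cox_ring\<^esub> g) = J +>\<^bsub>cox_ring\<^esub> (f * g)"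
    using h.hom_mult[of f g] by simp
  show "(J +>\<^bsub>cox_ring\<^esub> f) \<oplus>\<^bsub>cox_ring Quot J\<^esub> (J +>\<^bsub>cox_ring\<^esub> g) = J +>\<^bsub>cox_ring\<^esub> (f + g)"
    using h.hom_add[of f g] by simp
  show "\<one>\<^bsub>cox_ring Quot J\<^esub> = J +>\<^bsub>cox_ring\<^esub> 1" using h.hom_one by simp
  show "\<zero>\<^bsub>cox_ring Quot J\<^esub> = J +>\<^bsub>cox_ring\<^esub> 0" using h.hom_zero by simp
qed

text \<open>The target of \<open>map_exponents \<theta>\<close> is the monoid algebra of a linearly ordered cancellative monoid,
  which has no zero divisors because leading terms multiply. Hence the kernel is prime, and it
  stays prime in every quotient by an ideal that it contains.\<close>

lemma prime_kernel_in_quotient: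
  fixes \<theta> :: "('r \<Rightarrow>\<^sub>0 nat) \<Rightarrow> 'b::{ordered_cancel_comm_monoid_add, linorder}"
    and J :: "('r, 'k::field) mpoly set"
  assumes J: "ideal J cox_ring" and \<theta>: "\<And>u w. \<theta> (u + w) = \<theta> u + \<theta> w"
    and ker: "\<And>f. f \<in> J \<Longrightarrow> map_exponents \<theta> f = 0"
  defines "P \<equiv> (\<lambda>f. J +>\<^bsub>cox_ring\<^esub> f) ` {f. map_exponents \<theta> f = 0}"
  shows "primeideal P (cox_ring Quot J)"
    and "\<And>f. J +>\<^bsub>cox_ring\<^esub> f \<in> P \<longleftrightarrow> map_exponents \<theta> f = 0"
proof -
  show mem: "J +>\<^bsub>cox_ring\<^esub> f \<in> P \<longleftrightarrow> map_exponents \<theta> f = 0" for f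
  proof
    assume "J +>\<^bsub>cox_ring\<^esub> f \<in> P"
    then obtain g where "map_exponents \<theta> g = 0" "J +>\<^bsub>cox_ring\<^esub> f = J +>\<^bsub>cox_ring\<^esub> g"
      by (auto simp: P_def)
    thus "map_exponents \<theta> f = 0"
      using ker[of "f - g"] by (simp add: coset_eq_iff[OF J] map_exponents_diff)
  qed (auto simp: P_def)
  have cring: "cring (cox_ring Quot J)"
    by (rule ideal.quotient_is_cring[OF J cring_cox_ring])
  interpret Q: cring "cox_ring Quot J" by (rule cring)
  note [simp] = quotient_simps[OF J] map_exponents_add map_exponents_mult[OF \<theta>] mem
  have neg: "\<ominus>\<^bsub>cox_ring Quot J\<^esub> (J +>\<^bsub>cox_ring\<^esub> f) = J +>\<^bsub>cox_ring\<^esub> (- f)" for f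
    by (rule Q.minus_equality) simp_all
  have neg0: "map_exponents \<theta> (- f) = - map_exponents \<theta> f" for f :: "('r, 'k) mpoly"
    using map_exponents_diff[of \<theta> 0 f] by simp
  show "primeideal P (cox_ring Quot J)"
  proof (rule primeidealI2)
    show "additive_subgroup P (cox_ring Quot J)"
    proof (unfold additive_subgroup_def, rule Q.add.subgroupI)
      show "P \<noteq> {}" unfolding P_def using map_exponents_zero by blast
      show "P \<subseteq> carrier (cox_ring Quot J)" by (auto simp: P_def)
    next
      fix a assume "a \<in> P"
      then obtain f where "a = J +>\<^bsub>cox_ring\<^esub> f" "map_exponents \<theta> f = 0" by (auto simp: P_def)
      thus "\<ominus>\<^bsub>cox_ring Quot J\<^esub> a \<in> P"
        by (simp add: neg neg0)
    next
      fix a b assume "a \<in> P" "b \<in> P"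
      then obtain f g where "a = J +>\<^bsub>cox_ring\<^esub> f" "map_exponents \<theta> f = 0"
          "b = J +>\<^bsub>cox_ring\<^esub> g" "map_exponents \<theta> g = 0" by (auto simp: P_def)
      thus "a \<oplus>\<^bsub>cox_ring Quot J\<^esub> b \<in> P" by simp
    qed
  next
    have "map_exponents \<theta> (1::('r, 'k) mpoly) = Poly_Mapping.single (\<theta> 0) 1"
      by (metis map_exponents_single single_one)
    hence "J +>\<^bsub>cox_ring\<^esub> 1 \<notin> P" by (metis lookup_single_eq lookup_zero mem zero_neq_one)
    thus "carrier (cox_ring Quot J) \<noteq> P"
      unfolding quotient_simps(1)[OF J] by blast
  next
    show "x \<otimes>\<^bsub>cox_ring Quot J\<^esub> a \<in> P" "a \<otimes>\<^bsub>cox_ring Quot J\<^esub> x \<in> P"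
      if "a \<in> P" "x \<in> carrier (cox_ring Quot J)" for a x
      using that by (auto simp: P_def intro!: imageI)
  qed (auto simp: cring)
qed

section \<open>Lattice ideals\<close>

definition exponent_vector :: "('r::finite \<Rightarrow>\<^sub>0 nat) \<Rightarrow> int ^ 'r" where
  "exponent_vector u = (\<chi> i. int (Poly_Mapping.lookup u i))"

text \<open>Negative entries are truncated to \<open>0\<close> by the conversion from integers to naturals, so that
  \<open>pos_part m\<close> and \<open>pos_part (- m)\<close> are the exponents of the two terms of a lattice binomial.\<close>

definition pos_part :: "int ^ 'r \<Rightarrow> ('r::finite \<Rightarrow>\<^sub>0 nat)" where
  "pos_part m = Abs_poly_mapping (\<lambda>i. nat (m $ i))"

lemma lookup_pos_part [simp]: "Poly_Mapping.lookup (pos_part m) i = nat (m $ i)"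
  by (simp add: pos_part_def)

lemma exponent_vector_add: "exponent_vector (u + w) = exponent_vector u + exponent_vector w"
  by (simp add: exponent_vector_def vec_eq_iff lookup_add)

lemma exponent_vector_pos_part:
  fixes m :: "int ^ 'r::finite"
  assumes "\<And>i. 0 \<le> m $ i"
  shows "exponent_vector (pos_part m) = m"
  using assms by (simp add: exponent_vector_def vec_eq_iff)

lemma exponent_vector_pos_part_diff: "exponent_vector (pos_part m) - exponent_vector (pos_part (- m)) = m"
  by (simp add: exponent_vector_def vec_eq_iff)

lemma monomial_degree_eq: "monomial_degree \<beta> u = \<beta> *v exponent_vector u"
  by (simp add: monomial_degree_def matrix_mult_sum exponent_vector_def)

text \<open>Cosets are elements of the monoid of all subsets of the group under elementwise addition. This
  makes the quotient by a lattice available as an exponent monoid without a type of its own.\<close>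

definition lattice_coset :: "(int ^ 'r) set \<Rightarrow> ('r::finite \<Rightarrow>\<^sub>0 nat) \<Rightarrow> (int ^ 'r) set" where
  "lattice_coset L u = exponent_vector u +o L"

lemma sublattice_closed:
  assumes "sublattice L"
  shows "0 \<in> L" "x \<in> L \<Longrightarrow> y \<in> L \<Longrightarrow> x - y \<in> L" "x \<in> L \<Longrightarrow> - x \<in> L" "x \<in> L \<Longrightarrow> y \<in> L \<Longrightarrow> x + y \<in> L"
proof -
  show 0: "0 \<in> L" and 1: "x \<in> L \<Longrightarrow> y \<in> L \<Longrightarrow> x - y \<in> L" for x y
    using assms by (auto simp: sublattice_def)
  show 2: "x \<in> L \<Longrightarrow> - x \<in> L" for x using 1[OF 0, of x] by simp
  show "x \<in> L \<Longrightarrow> y \<in> L \<Longrightarrow> x + y \<in> L" using 1[OF _ 2, of x y] by simp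
qed

lemma sublattice_smult:
  assumes "sublattice L" "x \<in> L"
  shows "c *s x \<in> L"
proof -
  note L = sublattice_closed[OF assms(1)]
  have *: "int n *s x \<in> L" for n
    by (induction n) (auto simp: L assms(2) vector_sadd_rdistrib)
  show ?thesis
  proof (cases c rule: int_cases2)
    case (nonneg n)
    thus ?thesis using * by simp
  next
    case (nonpos n)
    have "c *s x = - (int n *s x)" by (simp add: nonpos vec_eq_iff)
    thus ?thesis using L(3)[OF *] by simp
  qed
qed

lemma translate_eq_iff:
  assumes "sublattice L"
  shows "a +o L = b +o L \<longleftrightarrow> a - b \<in> L"
proof
  note L = sublattice_closed[OF assms]
  show "a - b \<in> L" if "a +o L = b +o L"
  proof -
    have "a \<in> a +o L" using L(1) by (auto simp: elt_set_plus_def)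
    thus ?thesis unfolding that by (simp add: set_minus_plus)
  qed
  show "a +o L = b +o L" if "a - b \<in> L"
  proof -
    have "x - a \<in> L \<longleftrightarrow> x - b \<in> L" for x
      using L(4)[OF _ that, of "x - a"] L(2)[OF _ that, of "x - b"] by auto
    thus ?thesis by (auto simp flip: set_minus_plus)
  qed
qed

lemma lattice_coset_eq_iff:
  assumes "sublattice L"
  shows "lattice_coset L u = lattice_coset L w \<longleftrightarrow> exponent_vector u - exponent_vector w \<in> L"
  unfolding lattice_coset_def by (rule translate_eq_iff[OF assms])

text \<open>Additivity rests on \<open>L + L = L\<close>.\<close>

lemma lattice_coset_add:
  assumes "sublattice L"
  shows "lattice_coset L (u + w) = lattice_coset L u + lattice_coset L w"
proof -
  note L = sublattice_closed[OF assms]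
  have "L + L \<subseteq> L" by (auto simp: set_plus_def L)
  moreover have "L \<subseteq> L + L" using L(1) by (rule set_zero_plus2)
  ultimately show ?thesis
    unfolding lattice_coset_def exponent_vector_add set_plus_rearrange by simp
qed

lemma lattice_ideal_eq:
  "lattice_ideal L = Idl\<^bsub>cox_ring\<^esub> {Poly_Mapping.single (pos_part m) (1::'k::field)
      - Poly_Mapping.single (pos_part (- m)) 1 | m. m \<in> L}"
  by (simp add: lattice_ideal_def pos_monomial_def pos_part_def)

lemma ideal_lattice_ideal: "ideal (lattice_ideal L) cox_ring"
  unfolding lattice_ideal_def
  by (rule ring.genideal_ideal[OF cring.axioms(1)[OF cring_cox_ring]]) simp

text \<open>The kernel of \<open>map_exponents \<theta>\<close> is an ideal, so it suffices that the generating binomials are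
  killed.\<close>

lemma map_exponents_lattice_ideal:
  fixes \<theta> :: "('r::finite \<Rightarrow>\<^sub>0 nat) \<Rightarrow> 'b::comm_monoid_add" and f :: "('r, 'k::field) mpoly"
  assumes \<theta>: "\<And>u w. \<theta> (u + w) = \<theta> u + \<theta> w"
    and L: "\<And>m. m \<in> L \<Longrightarrow> \<theta> (pos_part m) = \<theta> (pos_part (- m))"
    and f: "f \<in> lattice_ideal L"
  shows "map_exponents \<theta> f = 0"
proof -
  have "ideal {f :: ('r, 'k) mpoly. map_exponents \<theta> f = 0} cox_ring"
    by (rule ideal_cox_ringI) (simp_all add: map_exponents_add map_exponents_mult[OF \<theta>])
  hence "lattice_ideal L \<subseteq> {f :: ('r, 'k) mpoly. map_exponents \<theta> f = 0}"
    unfolding lattice_ideal_eq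
    by (rule ring.genideal_minimal[OF cring.axioms(1)[OF cring_cox_ring]])
      (auto simp: map_exponents_diff L)
  thus ?thesis using f by auto
qed

text \<open>In other words, for \<open>f\<close> in the lattice ideal the coefficients of \<open>f\<close> over each coset of \<open>L\<close> sum
  to zero. This is the tool for showing that something is not in the ideal.\<close>

lemma map_lattice_coset_eq_0:
  assumes "sublattice L" "f \<in> lattice_ideal L"
  shows "map_exponents (lattice_coset L) f = 0"
  using assms
  by (intro map_exponents_lattice_ideal[OF lattice_coset_add])
    (auto simp: lattice_coset_eq_iff exponent_vector_pos_part_diff)

text \<open>With \<open>m = u - w\<close>, the binomial is the multiple of the generator of \<open>m\<close> by the greatest common
  divisor of the two monomials; its exponent is \<open>u - pos_part m\<close>.\<close>

lemma binomial_in_lattice_ideal: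
  assumes "exponent_vector u - exponent_vector w \<in> L"
  shows "Poly_Mapping.single u c - Poly_Mapping.single w (c::'k::field) \<in> lattice_ideal L"
proof -
  define m where "m = exponent_vector u - exponent_vector w"
  have m: "m $ i = int (Poly_Mapping.lookup u i) - int (Poly_Mapping.lookup w i)" for i
    by (simp add: m_def exponent_vector_def)
  have u: "u = (u - pos_part m) + pos_part m" and w: "w = (u - pos_part m) + pos_part (- m)"
    by (rule poly_mapping_eqI; simp add: lookup_add lookup_minus m)+
  have "Poly_Mapping.single (pos_part m) (1::'k) - Poly_Mapping.single (pos_part (- m)) 1
      \<in> lattice_ideal L"
    unfolding lattice_ideal_eq using assms
    by (intro subsetD[OF ring.genideal_self[OF cring.axioms(1)[OF cring_cox_ring]]])
      (auto simp: m_def intro!: exI[of _ m])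
  from ideal_cox_ring_mult[OF ideal_lattice_ideal this, of "Poly_Mapping.single (u - pos_part m) c"]
  show ?thesis by (subst u, subst w) (simp add: algebra_simps mult_single)
qed

lemma keys_map_exponents: "Poly_Mapping.keys (map_exponents \<theta> f) \<subseteq> \<theta> ` Poly_Mapping.keys f"
  unfolding map_exponents_def by (rule order_trans[OF keys_sum]) auto

lemma monomial_notin_lattice_ideal:
  assumes "sublattice L"
  shows "Poly_Mapping.single u (1::'k::field) \<notin> lattice_ideal L"
proof
  assume "Poly_Mapping.single u (1::'k) \<in> lattice_ideal L"
  from map_lattice_coset_eq_0[OF assms this]
  have "Poly_Mapping.lookup (Poly_Mapping.single (lattice_coset L u) (1::'k)) (lattice_coset L u) = 0"
    by simp
  thus False by simp
qed

text \<open>If \<open>m\<close> in \<open>L\<close> had nonzero degree, the two terms of its binomial would have different degrees, and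
  homogeneity would put a monomial into the ideal. The coefficients over the coset of that monomial
  would then sum to one.\<close>

lemma homogeneous_lattice_ideal_imp_subset:
  assumes L: "sublattice L" and hom: "homogeneous_ideal \<beta> (lattice_ideal L :: ('r::finite, 'k::field) mpoly set)"
  shows "L \<subseteq> kernel_lattice \<beta>"
proof (rule ccontr)
  assume "\<not> L \<subseteq> kernel_lattice \<beta>"
  then obtain m where m: "m \<in> L" "\<beta> *v m \<noteq> 0" by (auto simp: kernel_lattice_def)
  let ?u = "pos_part m" and ?w = "pos_part (- m)"
  let ?f = "Poly_Mapping.single ?u (1::'k) - Poly_Mapping.single ?w 1"
  have "monomial_degree \<beta> ?u - monomial_degree \<beta> ?w = \<beta> *v m"
    unfolding monomial_degree_eq matrix_vector_mult_diff_distrib[symmetric] exponent_vector_pos_part_diff ..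
  hence deg: "monomial_degree \<beta> ?u \<noteq> monomial_degree \<beta> ?w" using m(2) by auto
  hence ne: "?u \<noteq> ?w" by auto
  have "?f \<in> lattice_ideal L"
    using m(1) by (intro binomial_in_lattice_ideal) (simp add: exponent_vector_pos_part_diff)
  hence "homogeneous_component \<beta> (monomial_degree \<beta> ?u) ?f \<in> lattice_ideal L"
    using hom by (simp add: homogeneous_ideal_def)
  moreover have "{u \<in> Poly_Mapping.keys ?f. monomial_degree \<beta> u = monomial_degree \<beta> ?u} = {?u}"
    using deg ne by (auto simp: in_keys_iff lookup_minus lookup_single when_def split: if_splits)
  hence "homogeneous_component \<beta> (monomial_degree \<beta> ?u) ?f = Poly_Mapping.single ?u 1"
    using ne by (simp add: homogeneous_component_def lookup_minus lookup_single when_def)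
  ultimately show False using monomial_notin_lattice_ideal[OF L] by metis
qed

section \<open>The Hilbert function of a lattice ideal\<close>

text \<open>Adjoining one generator to a span is adjoining one more exponent that may occur in the
  representing polynomials.\<close>

lemma Span_monomials:
  fixes J :: "('r, 'k::field) mpoly set"
  assumes J: "ideal J cox_ring" and "distinct us"
  shows "ring.Span (cox_ring Quot J) (range (\<lambda>c. J +>\<^bsub>cox_ring\<^esub> Poly_Mapping.single 0 c))
      (map (\<lambda>u. J +>\<^bsub>cox_ring\<^esub> Poly_Mapping.single u 1) us)
    = (\<lambda>f. J +>\<^bsub>cox_ring\<^esub> f) ` {f. Poly_Mapping.keys f \<subseteq> set us}"
  using assms(2)
proof (induction us)
  interpret Q: ring "cox_ring Quot J" by (rule ideal.quotient_is_ring[OF J])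
  let ?q = "\<lambda>f. J +>\<^bsub>cox_ring\<^esub> f"
  note [simp] = quotient_simps[OF J]
  case Nil
  show ?case by auto
next
  interpret Q: ring "cox_ring Quot J" by (rule ideal.quotient_is_ring[OF J])
  let ?q = "\<lambda>f. J +>\<^bsub>cox_ring\<^esub> f"
  let ?P = "\<lambda>us. {f :: ('r, 'k) mpoly. Poly_Mapping.keys f \<subseteq> set us}"
  note [simp] = quotient_simps[OF J]
  case (Cons u us)
  have "x \<in> Q.line_extension (range (\<lambda>c. ?q (Poly_Mapping.single 0 c))) (?q (Poly_Mapping.single u 1))
      (?q ` ?P us) \<longleftrightarrow> x \<in> ?q ` ?P (u # us)" for x
  proof
    assume "x \<in> Q.line_extension (range (\<lambda>c. ?q (Poly_Mapping.single 0 c))) (?q (Poly_Mapping.single u 1)) (?q ` ?P us)"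
    then obtain c g where "x = ?q (Poly_Mapping.single u c + g)" "g \<in> ?P us"
      by (auto simp: Q.line_extension_mem_iff mult_single)
    moreover have "Poly_Mapping.single u c + g \<in> ?P (u # us)"
      using calculation(2) keys_add[of "Poly_Mapping.single u c" g] by (auto split: if_splits)
    ultimately show "x \<in> ?q ` ?P (u # us)" by blast
  next
    assume "x \<in> ?q ` ?P (u # us)"
    then obtain f where f: "x = ?q f" "Poly_Mapping.keys f \<subseteq> insert u (set us)" by auto
    define g where "g = f - Poly_Mapping.single u (Poly_Mapping.lookup f u)"
    have g: "Poly_Mapping.lookup g w = (if w = u then 0 else Poly_Mapping.lookup f w)" for w
      by (auto simp: g_def lookup_minus lookup_single)
    have "g \<in> ?P us"
      using f(2) by (auto simp: in_keys_iff g split: if_splits)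
    moreover have "x = (?q (Poly_Mapping.single 0 (Poly_Mapping.lookup f u)) \<otimes>\<^bsub>cox_ring Quot J\<^esub> ?q (Poly_Mapping.single u 1))
        \<oplus>\<^bsub>cox_ring Quot J\<^esub> ?q g"
      by (simp add: f(1) mult_single g_def)
    ultimately show "x \<in> Q.line_extension (range (\<lambda>c. ?q (Poly_Mapping.single 0 c))) (?q (Poly_Mapping.single u 1)) (?q ` ?P us)"
      unfolding Q.line_extension_mem_iff by blast
  qed
  thus ?case using Cons by auto
qed

text \<open>The residue classes of constants form the image of the field \<open>'k\<close> under a ring homomorphism to a
  nonzero ring.\<close>

lemma subfield_constants:
  fixes J :: "('r, 'k::field) mpoly set"
  assumes J: "ideal J cox_ring" and "1 \<notin> J"
  shows "subfield (range (\<lambda>c. J +>\<^bsub>cox_ring\<^esub> Poly_Mapping.single 0 c)) (cox_ring Quot J)"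
proof -
  let ?K = "ring_of_type_algebra :: 'k ring" and ?h = "\<lambda>c. J +>\<^bsub>cox_ring\<^esub> Poly_Mapping.single 0 c"
  note [simp] = quotient_simps[OF J]
  have simps [simp]: "carrier ?K = UNIV" "mult ?K = (*)" "one ?K = 1" "add ?K = (+)"
    by (simp_all add: ring_of_type_algebra_def fun_eq_iff)
  interpret K: Ring.field ?K by (rule field_from_type_algebra)
  interpret Q: ring "cox_ring Quot J" by (rule ideal.quotient_is_ring[OF J])
  interpret h: ring_hom_ring ?K "cox_ring Quot J" ?h
    by (rule ring_hom_ringI) (auto simp: K.ring_axioms Q.ring_axioms mult_single single_add)
  have "\<one>\<^bsub>cox_ring Quot J\<^esub> \<noteq> \<zero>\<^bsub>cox_ring Quot J\<^esub>"
    using assms(2) by (simp add: coset_eq_iff[OF J])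
  from h.img_is_subfield(2)[OF K.carrier_is_subfield this] show ?thesis by simp
qed

text \<open>Two monomials are congruent modulo the lattice ideal exactly when their exponents lie in the same
  coset of \<open>L\<close>, and monomials from distinct cosets are linearly independent in the quotient because
  their images under the coset map have distinct exponents. So the monomials of degree \<open>\<alpha>\<close>, one per
  coset that they meet, form a basis of the graded piece.\<close>

lemma hilbert_function_lattice_ideal:
  fixes L :: "(int ^ 'r::finite) set"
  assumes L: "sublattice L" "L \<subseteq> kernel_lattice \<beta>"
    and fin: "finite (lattice_coset L ` {u. monomial_degree \<beta> u = \<alpha>})"
  shows "hilbert_function \<beta> (lattice_ideal L :: ('r, 'k::field) mpoly set) \<alpha>
    = card (lattice_coset L ` {u. monomial_degree \<beta> u = \<alpha>})"
proof -
  let ?I = "lattice_ideal L :: ('r, 'k::field) mpoly set"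
  let ?q = "\<lambda>f. ?I +>\<^bsub>cox_ring\<^esub> f"
  let ?D = "{u. monomial_degree \<beta> u = \<alpha>}"
  let ?K = "range (\<lambda>c. ?q (Poly_Mapping.single 0 c))"
  let ?mono = "\<lambda>u. ?q (Poly_Mapping.single u 1)"
  have J: "ideal ?I cox_ring" by (rule ideal_lattice_ideal)
  note [simp] = quotient_simps[OF J]
  interpret Q: ring "cox_ring Quot ?I" by (rule ideal.quotient_is_ring[OF J])
  have "1 \<notin> ?I" using monomial_notin_lattice_ideal[OF L(1), of 0] by (metis single_one)
  note K = subfield_constants[OF J this]
  have indep: "Q.independent ?K (map ?mono us)" if "distinct (map (lattice_coset L) us)" for us
    using that
  proof (induction us)
    case (Cons u us)
    have "?mono u \<notin> Q.Span ?K (map ?mono us)"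
    proof
      assume "?mono u \<in> Q.Span ?K (map ?mono us)"
      then obtain f where f: "Poly_Mapping.keys f \<subseteq> set us" "?mono u = ?q f"
        using Span_monomials[OF J, of us] Cons.prems by (auto simp: distinct_map)
      hence "map_exponents (lattice_coset L) (Poly_Mapping.single u 1 - f) = 0"
        by (intro map_lattice_coset_eq_0 L) (simp add: coset_eq_iff[OF J])
      hence "Poly_Mapping.single (lattice_coset L u) 1 = map_exponents (lattice_coset L) f"
        by (simp add: map_exponents_diff)
      hence "lattice_coset L u \<in> Poly_Mapping.keys (map_exponents (lattice_coset L) f)"
        by (metis in_keys_iff lookup_single_eq zero_neq_one)
      thus False using keys_map_exponents[of "lattice_coset L" f] f(1) Cons.prems by auto
    qed
    thus ?case using Cons by (auto intro!: Q.li_Cons)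
  qed auto
  obtain cs where cs: "set cs = lattice_coset L ` ?D" "distinct cs"
    using finite_distinct_list[OF fin] by blast
  define rep where "rep c = (SOME u. u \<in> ?D \<and> lattice_coset L u = c)" for c
  have rep: "rep c \<in> ?D" "lattice_coset L (rep c) = c" if "c \<in> lattice_coset L ` ?D" for c
    using someI_ex[of "\<lambda>u. u \<in> ?D \<and> lattice_coset L u = c"] that by (auto simp: rep_def)
  let ?us = "map rep cs"
  have eq: "map (lattice_coset L) ?us = cs"
    unfolding map_map by (rule map_idI) (use rep(2) cs(1) in auto)
  hence dist: "distinct (map (lattice_coset L) ?us)" using cs(2) by metis
  hence dist': "distinct ?us" by (rule distinct_map[THEN iffD1, THEN conjunct1])
  have span: "Q.Span ?K (map ?mono ?us) = ?q ` graded_piece \<beta> \<alpha>"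
    unfolding Span_monomials[OF J dist']
  proof (intro equalityI image_subsetI)
    fix f :: "('r, 'k) mpoly" assume "f \<in> {f. Poly_Mapping.keys f \<subseteq> set ?us}"
    moreover have "monomial_degree \<beta> u = \<alpha>" if "u \<in> set ?us" for u
      using that rep(1) cs(1) by auto
    ultimately show "?q f \<in> ?q ` graded_piece \<beta> \<alpha>"
      unfolding graded_piece_def by (intro imageI) blast
  next
    fix f :: "('r, 'k) mpoly" assume f: "f \<in> graded_piece \<beta> \<alpha>"
    let ?\<theta> = "\<lambda>u. rep (lattice_coset L u)"
    define g where "g = map_exponents ?\<theta> f"
    have \<theta>: "?\<theta> u \<in> set ?us" "lattice_coset L (?\<theta> u) = lattice_coset L u"
      if "u \<in> Poly_Mapping.keys f" for u
      using that f rep(2)[of "lattice_coset L u"] by (auto simp: cs(1) graded_piece_def)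
    have "f - g = (\<Sum>u\<in>Poly_Mapping.keys f. Poly_Mapping.single u (Poly_Mapping.lookup f u)) - g"
      by (rule arg_cong[where f = "\<lambda>x. x - g", OF sum_of_monomials])
    also have "\<dots> = (\<Sum>u\<in>Poly_Mapping.keys f. Poly_Mapping.single u (Poly_Mapping.lookup f u)
        - Poly_Mapping.single (?\<theta> u) (Poly_Mapping.lookup f u))"
      by (simp add: g_def map_exponents_def sum_subtractf)
    also have "\<dots> \<in> ?I"
      using \<theta>(2)[symmetric]
      by (intro ideal_cox_ring_sum[OF J] binomial_in_lattice_ideal)
        (rule lattice_coset_eq_iff[OF L(1), THEN iffD1])
    finally have "?q f = ?q g" by (simp add: coset_eq_iff[OF J])
    moreover have "Poly_Mapping.keys g \<subseteq> set ?us"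
      using keys_map_exponents[of ?\<theta> f] \<theta>(1) by (auto simp: g_def)
    ultimately show "?q f \<in> ?q ` {f. Poly_Mapping.keys f \<subseteq> set ?us}" by blast
  qed
  have "Q.dimension (length (map ?mono ?us)) ?K (?q ` graded_piece \<beta> \<alpha>)"
    unfolding span[symmetric] by (rule Q.dimension_independent[OF indep[OF dist]])
  from Q.dimI[OF K this] show ?thesis
    using cs by (simp add: hilbert_function_def over_def distinct_card[symmetric])
qed

section \<open>The Krull dimension bounds the rank of the lattice\<close>

lemma krull_dim_ge_chain:
  assumes "\<And>i. i \<le> n \<Longrightarrow> primeideal (p i) R" "\<And>i. i < n \<Longrightarrow> p i \<subset> p (Suc i)"
  shows "enat n \<le> krull_dim R"
  unfolding krull_dim_def by (rule SUP_upper) (use assms in blast)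

text \<open>Let \<open>P k\<close> be the kernel of the map that records only the first \<open>k\<close> of the functionals \<open>w j\<close>; the
  exponents of the target, finitely supported functions from \<open>nat\<close> to the rationals, carry a
  lexicographic group order, so that \<open>P k\<close> is prime. Forgetting one more functional enlarges the
  kernel, strictly so because the binomial of \<open>b k\<close> is killed by \<open>w j\<close> for \<open>j < k\<close> and is not killed
  by \<open>w k\<close>. As \<open>k\<close> runs from \<open>s\<close> down to \<open>0\<close> this is a chain of \<open>s + 1\<close> primes over the lattice ideal.\<close>

lemma krull_dim_lattice_ideal_ge:
  fixes L :: "(int ^ 'r::finite) set" and w :: "nat \<Rightarrow> int ^ 'r \<Rightarrow> rat"
  assumes add: "\<And>j x y. j < s \<Longrightarrow> w j (x + y) = w j x + w j y"
    and L: "\<And>j l. j < s \<Longrightarrow> l \<in> L \<Longrightarrow> w j l = 0"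
    and b: "\<And>i j. i < s \<Longrightarrow> j < s \<Longrightarrow> w i (b j) = 0 \<longleftrightarrow> i \<noteq> j"
  shows "enat s \<le> krull_dim (cox_ring Quot (lattice_ideal L :: ('r, 'k::field) mpoly set))"
proof -
  let ?I = "lattice_ideal L :: ('r, 'k::field) mpoly set"
  let ?q = "\<lambda>f. ?I +>\<^bsub>cox_ring\<^esub> f"
  define \<theta> where "\<theta> k u = (\<Sum>j<k. Poly_Mapping.single j (w j (exponent_vector u)))"
    for k :: nat and u :: "'r \<Rightarrow>\<^sub>0 nat"
  define P where "P k = ?q ` {f. map_exponents (\<theta> k) f = 0}" for k
  have diff: "w j (x - y) = w j x - w j y" if "j < s" for j x y
    using add[OF that, of "x - y" y] by simp
  have pos: "w j (exponent_vector (pos_part m)) = w j (exponent_vector (pos_part (- m))) \<longleftrightarrow> w j m = 0"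
    if "j < s" for j m
    using diff[OF that, of "exponent_vector (pos_part m)" "exponent_vector (pos_part (- m))"]
    by (simp add: exponent_vector_pos_part_diff)
  have \<theta>_add: "\<theta> k (u + v) = \<theta> k u + \<theta> k v" if "k \<le> s" for k u v
    using that by (simp add: \<theta>_def exponent_vector_add add single_add sum.distrib)
  have \<theta>_L: "\<theta> k (pos_part m) = \<theta> k (pos_part (- m))" if "k \<le> s" "m \<in> L" for k m
    unfolding \<theta>_def
    by (intro sum.cong refl arg_cong[where f = "Poly_Mapping.single _"] pos[THEN iffD2] L) (use that in auto)
  have J: "ideal ?I cox_ring" by (rule ideal_lattice_ideal)
  have prime: "primeideal (P k) (cox_ring Quot ?I)"
    and mem: "?q f \<in> P k \<longleftrightarrow> map_exponents (\<theta> k) f = 0" if "k \<le> s" for k f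
    unfolding P_def
    using prime_kernel_in_quotient[OF J \<theta>_add[OF that] map_exponents_lattice_ideal[OF \<theta>_add[OF that] \<theta>_L[OF that]]]
    by simp_all
  have lookup: "Poly_Mapping.lookup (\<theta> k u) j = (if j < k then w j (exponent_vector u) else 0)" for k u j
    by (simp add: \<theta>_def lookup_sum lookup_single when_def)
  have strict: "P (Suc k) \<subset> P k" if k: "k < s" for k
  proof
    \<comment> \<open>The map for k factors through the map for Suc k by truncation.\<close>
    have "\<theta> k u = (\<Sum>j<k. Poly_Mapping.single j (Poly_Mapping.lookup (\<theta> (Suc k) u) j))" for u
      by (rule poly_mapping_eqI) (simp add: lookup lookup_sum lookup_single when_def)
    hence "map_exponents (\<theta> k) f = map_exponents (\<lambda>e. \<Sum>j<k. Poly_Mapping.single j (Poly_Mapping.lookup e j))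
        (map_exponents (\<theta> (Suc k)) f)" for f :: "('r, 'k) mpoly"
      unfolding map_exponents_comp by presburger
    thus "P (Suc k) \<subseteq> P k" unfolding P_def by auto
    let ?f = "Poly_Mapping.single (pos_part (b k)) (1::'k) - Poly_Mapping.single (pos_part (- b k)) 1"
    have "\<theta> k (pos_part (b k)) = \<theta> k (pos_part (- b k))"
      unfolding \<theta>_def
      by (intro sum.cong refl arg_cong[where f = "Poly_Mapping.single _"] pos[THEN iffD2] b[THEN iffD2])
        (use k in auto)
    hence "?q ?f \<in> P k" using k by (simp add: mem map_exponents_diff)
    moreover have "\<theta> (Suc k) (pos_part (b k)) \<noteq> \<theta> (Suc k) (pos_part (- b k))"
      using lookup[of "Suc k" _ k] pos[OF k] b[OF k k] by (metis lessI)
    hence "map_exponents (\<theta> (Suc k)) ?f \<noteq> 0"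
      unfolding map_exponents_diff map_exponents_single
      by (metis eq_iff_diff_eq_0 lookup_single_eq lookup_single_not_eq zero_neq_one)
    hence "?q ?f \<notin> P (Suc k)" using k by (simp add: mem)
    ultimately show "P (Suc k) \<noteq> P k" by blast
  qed
  show ?thesis
  proof (rule krull_dim_ge_chain[of _ "\<lambda>i. P (s - i)"])
    show "P (s - i) \<subset> P (s - Suc i)" if "i < s" for i
      using strict[of "s - Suc i"] that by (simp add: Suc_diff_Suc)
  qed (auto intro: prime)
qed

definition rat_vec :: "int ^ 'r \<Rightarrow> rat ^ 'r" where
  "rat_vec m = (\<chi> i. of_int (m $ i))"

lemma rat_vec_simps:
  "rat_vec (x + y) = rat_vec x + rat_vec y" "rat_vec (c *s x) = of_int c *s rat_vec x" "rat_vec 0 = 0"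
  "rat_vec x = rat_vec y \<longleftrightarrow> x = y"
  by (simp_all add: rat_vec_def vec_eq_iff)

lemma clear_denominators:
  fixes x :: "rat ^ 'r::finite"
  obtains k m where "k > 0" "rat_vec m = of_int k *s x"
proof -
  define k where "k = (\<Prod>i\<in>UNIV. snd (quotient_of (x $ i)))"
  have pos: "snd (quotient_of (x $ i)) > 0" for i by (rule quotient_of_denom_pos')
  have "\<exists>c. of_int c = of_int k * x $ i" for i
  proof -
    obtain a b where ab: "quotient_of (x $ i) = (a, b)" by fastforce
    have "b > 0" "x $ i = of_int a / of_int b"
      using quotient_of_denom_pos[OF ab] quotient_of_div[OF ab] by simp_all
    moreover have "b dvd k" unfolding k_def
      using dvd_prodI[of UNIV i "\<lambda>i. snd (quotient_of (x $ i))"] ab by simp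
    then obtain e where "k = b * e" by blast
    ultimately show ?thesis by (intro exI[of _ "a * e"]) simp
  qed
  then obtain c where "\<And>i. of_int (c i) = of_int k * x $ i" by metis
  hence "rat_vec (\<chi> i. c i) = of_int k *s x" by (simp add: rat_vec_def vec_eq_iff)
  moreover have "k > 0" unfolding k_def by (intro prod_pos) (simp add: pos)
  ultimately show ?thesis using that by blast
qed

text \<open>The rational vectors some positive multiple of which lies in \<open>L\<close> form a subspace.\<close>

lemma rat_span_sublattice:
  assumes L: "sublattice L" and "rat_vec m \<in> vec.span (rat_vec ` L)"
  shows "\<exists>k>0. k *s m \<in> L"
proof -
  note Lc = sublattice_closed[OF L]
  note mult = sublattice_smult[OF L]
  define T where "T = {x. \<exists>k>0. \<exists>l\<in>L. of_int k *s x = rat_vec l}"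
  have "vec.subspace T"
  proof (rule vec.subspaceI)
    show "0 \<in> T" using Lc(1) by (auto simp: T_def rat_vec_simps intro!: exI[of _ 1] bexI[of _ 0])
  next
    fix x y assume "x \<in> T" "y \<in> T"
    then obtain k l k' l' where *: "k > 0" "l \<in> L" "of_int k *s x = rat_vec l"
      "k' > 0" "l' \<in> L" "of_int k' *s y = rat_vec l'" by (auto simp: T_def)
    have "of_int (k * k') *s (x + y) = of_int k' *s (of_int k *s x) + of_int k *s (of_int k' *s y)"
      by (simp add: vec_eq_iff algebra_simps)
    also have "\<dots> = rat_vec (k' *s l + k *s l')" by (simp add: * rat_vec_simps)
    finally show "x + y \<in> T" unfolding T_def
      using * by (intro CollectI exI[of _ "k * k'"] conjI bexI[of _ "k' *s l + k *s l'"]) (auto intro: Lc mult)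
  next
    fix c x assume "x \<in> T"
    then obtain k l where *: "k > 0" "l \<in> L" "of_int k *s x = rat_vec l" by (auto simp: T_def)
    obtain a b where ab: "quotient_of c = (a, b)" by fastforce
    have c: "b > 0" "c = of_int a / of_int b"
      using quotient_of_denom_pos[OF ab] quotient_of_div[OF ab] by simp_all
    have "of_int (k * b) *s (c *s x) = of_int a *s (of_int k *s x)"
      using c by (simp add: vec_eq_iff)
    also have "\<dots> = rat_vec (a *s l)" by (simp add: * rat_vec_simps)
    finally show "c *s x \<in> T" unfolding T_def
      using * c(1) by (intro CollectI exI[of _ "k * b"] conjI bexI[of _ "a *s l"]) (auto intro: mult)
  qed
  moreover have "rat_vec ` L \<subseteq> T" by (auto simp: T_def intro!: exI[of _ 1])
  ultimately have "rat_vec m \<in> T" using assms(2) vec.span_minimal by blast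
  thus ?thesis by (auto simp: T_def rat_vec_simps simp flip: rat_vec_simps(2))
qed

text \<open>A vector of infinite order modulo \<open>L\<close> forces the rational span of \<open>L\<close> to have dimension less than
  \<open>CARD('n)\<close>, so that its codimension in \<open>\<rat>\<^sup>r\<close> is at least \<open>d + 1\<close>. The coordinates with respect to a
  basis adapted to that span then provide \<open>d + 1\<close> functionals that vanish on \<open>L\<close>, and with them a chain
  of primes which is too long.\<close>

lemma torsion_of_krull_dim:
  fixes \<phi> :: "int ^ 'n ^ 'r" and L :: "(int ^ 'r) set"
  assumes L: "sublattice L" "L \<subseteq> range (\<lambda>y. \<phi> *v y)" and m: "m \<in> range (\<lambda>y. \<phi> *v y)"
    and card: "CARD('r) = CARD('n) + d"
    and dim: "krull_dim (cox_ring Quot (lattice_ideal L :: ('r, 'k::field) mpoly set)) = enat d"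
  shows "\<exists>k>0. k *s m \<in> L"
proof (rule ccontr)
  assume tf: "\<not> ?thesis"
  let ?V = "vec.span (rat_vec ` L)"
  have "rat_vec m \<notin> ?V" using rat_span_sublattice[OF L(1)] tf by blast
  obtain B where B: "B \<subseteq> ?V" "vec.independent B" "?V \<subseteq> vec.span B" "card B = vec.dim ?V"
    using vec.basis_exists by blast
  have "vec.span B = ?V" using B vec.span_minimal[OF B(1)] by auto
  hence ind: "vec.independent (insert (rat_vec m) B)"
    using B(2) \<open>rat_vec m \<notin> ?V\<close> by (simp add: vec.independent_insert)
  define G where "G = (\<lambda>i. rat_vec (column i \<phi>)) ` UNIV"
  have range: "rat_vec (\<phi> *v y) \<in> vec.span G" for y
  proof -
    have "rat_vec (\<phi> *v y) = (\<Sum>i\<in>UNIV. of_int (y $ i) *s rat_vec (column i \<phi>))"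
      by (simp add: matrix_mult_sum rat_vec_def vec_eq_iff)
    also have "\<dots> \<in> vec.span G"
      by (intro vec.span_sum vec.span_scale vec.span_base) (simp add: G_def)
    finally show ?thesis .
  qed
  have "?V \<subseteq> vec.span G" using L(2) range by (intro vec.span_minimal) auto
  hence "insert (rat_vec m) B \<subseteq> vec.span G" using B(1) m range by auto
  hence "card (insert (rat_vec m) B) \<le> card G"
    using vec.independent_span_bound[OF _ ind, of G] by (simp add: G_def)
  also have "\<dots> \<le> CARD('n)" unfolding G_def by (rule card_image_le) simp
  finally have le: "card (insert (rat_vec m) B) \<le> CARD('n)" .
  have "rat_vec m \<notin> B" using B(1) \<open>rat_vec m \<notin> ?V\<close> by blast
  hence "Suc (card B) \<le> CARD('n)"
    using card_insert_disjoint[OF vec.finiteI_independent[OF B(2)]] le by simp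
  \<comment> \<open>Coordinates along the vectors of C outside B vanish on the span of L.\<close>
  define C where "C = vec.extend_basis B"
  have C: "B \<subseteq> C" "vec.independent C" "vec.span C = UNIV"
    using B(2) by (simp_all add: C_def vec.extend_basis_superset vec.independent_extend_basis)
  have finC: "finite C" using C(2) by (rule vec.finiteI_independent)
  have "card C = CARD('r)" using vec.dim_eq_card[OF _ C(2), of UNIV] C(3) by (simp add: card_cart_basis)
  hence "Suc d \<le> card (C - B)"
    using card \<open>Suc (card B) \<le> CARD('n)\<close> card_Diff_subset[OF finite_subset[OF C(1) finC] C(1)] by simp
  then obtain c where c: "inj_on c {..<Suc d}" "c ` {..<Suc d} \<subseteq> C - B"
    using card_le_inj[of "{..<Suc d}" "C - B"] finC by auto
  have "\<exists>b k. k > 0 \<and> rat_vec b = of_int k *s c j" for j using clear_denominators by metis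
  then obtain b k where bk: "\<And>j. k j > 0" "\<And>j. rat_vec (b j) = of_int (k j) *s c j" by metis
  define w where "w j x = vec.representation C (rat_vec x) (c j)" for j x
  have "enat (Suc d) \<le> krull_dim (cox_ring Quot (lattice_ideal L :: ('r, 'k::field) mpoly set))"
  proof (rule krull_dim_lattice_ideal_ge[of _ w _ b])
    show "w j (x + y) = w j x + w j y" for j x y
      by (simp add: w_def rat_vec_simps vec.representation_add C)
  next
    fix j l assume j: "j < Suc d" and "l \<in> L"
    have "vec.subspace {x. vec.representation C x (c j) = 0}"
      by (rule vec.subspaceI) (simp_all add: vec.representation_zero vec.representation_add vec.representation_scale C)
    moreover have "B \<subseteq> {x. vec.representation C x (c j) = 0}"
    proof
      fix x assume "x \<in> B"
      hence "x \<in> C" "c j \<noteq> x" using C(1) c(2) j by auto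
      thus "x \<in> {x. vec.representation C x (c j) = 0}"
        by (simp add: vec.representation_basis[OF C(2)])
    qed
    ultimately have "?V \<subseteq> {x. vec.representation C x (c j) = 0}"
      using \<open>vec.span B = ?V\<close> vec.span_minimal by blast
    moreover have "rat_vec l \<in> ?V" using \<open>l \<in> L\<close> by (auto intro: vec.span_base)
    ultimately show "w j l = 0" by (auto simp: w_def)
  next
    fix i j assume ij: "i < Suc d" "j < Suc d"
    have "c i = c j \<longleftrightarrow> i = j" using c(1) ij by (auto simp: inj_on_def)
    moreover have "c j \<in> C" using c(2) ij by auto
    ultimately show "(w i (b j) = 0) = (i \<noteq> j)"
      using bk(1)[of j] by (simp add: w_def bk(2) vec.representation_scale vec.representation_basis C)
  qed
  thus False using dim by simp
qed

section \<open>Integral bases and invariant factors\<close>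

definition lin_comb :: "'i set \<Rightarrow> ('i \<Rightarrow> int) \<Rightarrow> ('i \<Rightarrow> int ^ 'm) \<Rightarrow> int ^ 'm" where
  "lin_comb J c b = (\<Sum>i\<in>J. c i *s b i)"

definition int_span :: "'i set \<Rightarrow> ('i \<Rightarrow> int ^ 'm) \<Rightarrow> (int ^ 'm) set" where
  "int_span J b = range (\<lambda>c. lin_comb J c b)"

definition int_independent :: "'i set \<Rightarrow> ('i \<Rightarrow> int ^ 'm) \<Rightarrow> bool" where
  "int_independent J b \<longleftrightarrow> (\<forall>c. lin_comb J c b = 0 \<longrightarrow> (\<forall>i\<in>J. c i = 0))"

lemma lin_comb_add: "lin_comb J (\<lambda>i. c i + e i) b = lin_comb J c b + lin_comb J e b"
  by (simp add: lin_comb_def vector_sadd_rdistrib sum.distrib)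

lemma lin_comb_smult: "lin_comb J (\<lambda>i. q * c i) b = q *s lin_comb J c b"
  by (simp add: lin_comb_def vec_eq_iff sum_distrib_left algebra_simps)

lemma lin_comb_diff: "lin_comb J (\<lambda>i. c i - e i) b = lin_comb J c b - lin_comb J e b"
  using lin_comb_add[of J "\<lambda>i. c i - e i" e b] by simp

lemma lin_comb_scale: "lin_comb J c (\<lambda>i. e i *s b i) = lin_comb J (\<lambda>i. c i * e i) b"
  by (simp add: lin_comb_def vector_smult_assoc)

lemma lin_comb_cong:
  assumes "\<And>i. i \<in> J \<Longrightarrow> c i = c' i" "\<And>i. i \<in> J \<Longrightarrow> b i = b' i"
  shows "lin_comb J c b = lin_comb J c' b'"
  using assms by (auto simp: lin_comb_def intro: sum.cong)

lemma lin_comb_insert: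
  assumes "finite J" "k \<notin> J"
  shows "lin_comb (insert k J) c b = c k *s b k + lin_comb J c b"
  using assms by (simp add: lin_comb_def)

lemma lin_comb_single:
  assumes "finite J" "k \<in> J"
  shows "lin_comb J (\<lambda>i. if i = k then a else 0) b = a *s b k"
  using assms by (simp add: lin_comb_def if_distrib[of "\<lambda>x. x *s _"] cong: if_cong)

lemma lin_comb_in_int_span [simp]: "lin_comb J c b \<in> int_span J b"
  by (simp add: int_span_def)

lemma int_span_closed:
  assumes "x \<in> int_span J b" "y \<in> int_span J b"
  shows "x + y \<in> int_span J b" "q *s x \<in> int_span J b" "x - y \<in> int_span J b"
proof -
  obtain c e where "x = lin_comb J c b" "y = lin_comb J e b" using assms by (auto simp: int_span_def)
  thus "x + y \<in> int_span J b" "q *s x \<in> int_span J b" "x - y \<in> int_span J b"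
    by (simp_all flip: lin_comb_add lin_comb_smult lin_comb_diff)
qed

lemma zero_in_int_span [simp]: "0 \<in> int_span J b"
proof -
  have "lin_comb J (\<lambda>_. 0) b = 0" by (simp add: lin_comb_def)
  thus ?thesis using lin_comb_in_int_span by metis
qed

lemma generator_in_int_span: "finite J \<Longrightarrow> i \<in> J \<Longrightarrow> b i \<in> int_span J b"
  using lin_comb_single[of J i 1 b] lin_comb_in_int_span[of J _ b] by (metis vector_smult_lid)

lemma int_span_insert:
  assumes "finite J" "k \<notin> J"
  shows "int_span (insert k J) b = {q *s b k + z | q z. z \<in> int_span J b}"
proof (intro equalityI subsetI)
  fix x assume "x \<in> {q *s b k + z | q z. z \<in> int_span J b}"
  then obtain q c where "x = q *s b k + lin_comb J c b" by (auto simp: int_span_def)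
  also have "\<dots> = lin_comb (insert k J) (c(k := q)) b"
    using assms lin_comb_cong[of J c "c(k := q)" b b] by (simp add: lin_comb_insert) (metis fun_upd_other)
  finally show "x \<in> int_span (insert k J) b" by simp
qed (auto simp: int_span_def lin_comb_insert[OF assms])

lemma lin_comb_eq_iff:
  assumes "int_independent J b"
  shows "lin_comb J c b = lin_comb J e b \<longleftrightarrow> (\<forall>i\<in>J. c i = e i)"
proof
  assume "lin_comb J c b = lin_comb J e b"
  hence "lin_comb J (\<lambda>i. c i - e i) b = 0" by (simp add: lin_comb_diff)
  thus "\<forall>i\<in>J. c i = e i" using assms by (auto simp: int_independent_def)
qed (auto intro: lin_comb_cong)

lemma int_basis_iff:
  "int_basis J b M \<longleftrightarrow> int_independent J b \<and> int_span J b = M"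
proof -
  have "lin_comb J c b = lin_comb J (restrict c J) b" for c
    by (rule lin_comb_cong) auto
  hence image: "(\<lambda>c. lin_comb J c b) ` (J \<rightarrow>\<^sub>E UNIV) = int_span J b"
    unfolding int_span_def by (auto simp: image_iff intro!: bexI[of _ "restrict _ J"])
  have "inj_on (\<lambda>c. lin_comb J c b) (J \<rightarrow>\<^sub>E UNIV) \<longleftrightarrow> int_independent J b"
  proof
    assume ind: "int_independent J b"
    show "inj_on (\<lambda>c. lin_comb J c b) (J \<rightarrow>\<^sub>E UNIV)"
    proof (rule inj_onI)
      fix c e assume ce: "c \<in> J \<rightarrow>\<^sub>E UNIV" "e \<in> J \<rightarrow>\<^sub>E UNIV" "lin_comb J c b = lin_comb J e b"
      show "c = e" by (rule PiE_ext[OF ce(1,2)]) (use ce(3) in \<open>simp add: lin_comb_eq_iff[OF ind]\<close>)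
    qed
  next
    assume inj: "inj_on (\<lambda>c. lin_comb J c b) (J \<rightarrow>\<^sub>E UNIV)"
    show "int_independent J b" unfolding int_independent_def
    proof (intro allI impI)
      fix c assume "lin_comb J c b = 0"
      hence "lin_comb J (restrict c J) b = lin_comb J (restrict (\<lambda>_. 0) J) b"
        using lin_comb_cong[of J "restrict c J" c b b] lin_comb_cong[of J "restrict (\<lambda>_. 0) J" "\<lambda>_. 0" b b]
        by (simp add: lin_comb_def)
      hence "restrict c J = restrict (\<lambda>_. 0) J" by (intro inj_onD[OF inj]) auto
      thus "\<forall>i\<in>J. c i = 0" by (metis restrict_apply')
    qed
  qed
  with image show ?thesis
    unfolding int_basis_def bij_betw_def by (simp flip: lin_comb_def)
qed

lemma int_independent_insert:
  assumes "finite J" "k \<notin> J" "int_independent J b"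
    and "\<And>q z. z \<in> int_span J b \<Longrightarrow> q *s b k + z = 0 \<Longrightarrow> q = 0"
  shows "int_independent (insert k J) b"
  unfolding int_independent_def
proof (intro allI impI)
  fix c assume *: "lin_comb (insert k J) c b = 0"
  hence "c k = 0" using assms(4)[of "lin_comb J c b" "c k"] by (simp add: lin_comb_insert[OF assms(1,2)])
  moreover from this * have "lin_comb J c b = 0" by (simp add: lin_comb_insert[OF assms(1,2)])
  ultimately show "\<forall>i\<in>insert k J. c i = 0" using assms(3) by (auto simp: int_independent_def)
qed

lemma int_independent_insertD:
  assumes "finite J" "k \<notin> J" "int_independent (insert k J) b"
  shows "int_independent J b" "z \<in> int_span J b \<Longrightarrow> q *s b k + z = 0 \<Longrightarrow> q = 0"
proof -
  have *: "q = 0 \<and> (\<forall>i\<in>J. c i = 0)" if "q *s b k + lin_comb J c b = 0" for c q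
  proof -
    have "lin_comb J (c(k := q)) b = lin_comb J c b"
      using assms(2) by (intro lin_comb_cong) auto
    hence "lin_comb (insert k J) (c(k := q)) b = 0"
      using that by (simp add: lin_comb_insert[OF assms(1,2)])
    hence "\<forall>i\<in>insert k J. (c(k := q)) i = 0" using assms(3) unfolding int_independent_def by blast
    thus ?thesis using assms(2) by (metis fun_upd_apply insertCI)
  qed
  show "int_independent J b"
    unfolding int_independent_def using *[of 0] by simp
  show "z \<in> int_span J b \<Longrightarrow> q *s b k + z = 0 \<Longrightarrow> q = 0"
    using * by (auto simp: int_span_def)
qed

lemma int_span_cong: "(\<And>i. i \<in> J \<Longrightarrow> b i = b' i) \<Longrightarrow> int_span J b = int_span J b'"
  unfolding int_span_def by (intro image_cong refl lin_comb_cong)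

lemma int_independent_cong:
  "(\<And>i. i \<in> J \<Longrightarrow> b i = b' i) \<Longrightarrow> int_independent J b = int_independent J b'"
  unfolding int_independent_def using lin_comb_cong[of J _ _ b b'] by metis

text \<open>Elements of a basis other than \<open>b k\<close> may be replaced by another basis of their span, and \<open>b k\<close> may be
  modified by an element of that span: the change of basis is block triangular.\<close>

lemma int_basis_replace:
  assumes J: "finite J" "k \<notin> J" and b: "int_basis (insert k J) b M"
    and m: "int_basis J m (int_span J b)" and z: "m k = b k + z" "z \<in> int_span J b"
  shows "int_basis (insert k J) m M"
proof -
  note b = b[unfolded int_basis_iff] and m = m[unfolded int_basis_iff]
  have "int_independent (insert k J) m"
  proof (rule int_independent_insert[OF J])
    fix q y assume "y \<in> int_span J m" "q *s m k + y = 0"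
    hence "q *s b k + (q *s z + y) = 0" "q *s z + y \<in> int_span J b"
      using m z by (auto simp: vector_add_ldistrib algebra_simps intro: int_span_closed)
    thus "q = 0" using int_independent_insertD(2)[OF J] b by blast
  qed (use m in blast)
  moreover have "int_span (insert k J) m = int_span (insert k J) b"
    unfolding int_span_insert[OF J]
  proof (intro equalityI subsetI; clarify)
    fix q y assume "y \<in> int_span J m"
    hence "q *s m k + y = q *s b k + (q *s z + y)" "q *s z + y \<in> int_span J b"
      using m z by (auto simp: vector_add_ldistrib algebra_simps intro: int_span_closed)
    thus "\<exists>q' y'. q *s m k + y = q' *s b k + y' \<and> y' \<in> int_span J b" by blast
  next
    fix q y assume "y \<in> int_span J b"
    hence "q *s b k + y = q *s m k + (y - q *s z)" "y - q *s z \<in> int_span J m"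
      using m z by (auto simp: vector_add_ldistrib algebra_simps intro: int_span_closed)
    thus "\<exists>q' y'. q *s b k + y = q' *s m k + y' \<and> y' \<in> int_span J m" by blast
  qed
  ultimately show ?thesis using b by (simp add: int_basis_iff)
qed

text \<open>The change of basis behind division with remainder: it reduces all coefficients of a vector modulo
  its \<open>k\<close>-th coefficient at once, the quotients being absorbed into \<open>z\<close>.\<close>

lemma int_basis_shear:
  assumes J: "finite J" "k \<notin> J" and b: "int_basis (insert k J) b M" and z: "z \<in> int_span J b"
  shows "int_basis (insert k J) (b(k := b k + z)) M"
proof (rule int_basis_replace[OF J b _ _ z])
  have eq: "(b(k := b k + z)) i = b i" if "i \<in> J" for i using that J(2) by auto
  show "int_basis J (b(k := b k + z)) (int_span J b)"
    using int_independent_insertD(1)[OF J, of b] b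
      int_independent_cong[of J "b(k := b k + z)" b] int_span_cong[of J "b(k := b k + z)" b] eq
    unfolding int_basis_iff by metis
qed simp

lemma lin_comb_permute:
  assumes "bij_betw p J J"
  shows "lin_comb J (\<lambda>i. c (p i)) (\<lambda>i. b (p i)) = lin_comb J c b"
  unfolding lin_comb_def by (rule sum.reindex_bij_betw[OF assms])

lemma int_basis_permute:
  assumes "bij_betw p J J" "int_basis J b M"
  shows "int_basis J (\<lambda>i. b (p i)) M"
proof -
  define p' where "p' = inv_into J p"
  have p': "p' (p i) = i" if "i \<in> J" for i
    unfolding p'_def by (rule bij_betw_inv_into_left[OF assms(1) that])
  have eq: "lin_comb J c (\<lambda>i. b (p i)) = lin_comb J (\<lambda>i. c (p' i)) b" for c
    using lin_comb_permute[OF assms(1), of "\<lambda>i. c (p' i)" b] lin_comb_cong[of J c "\<lambda>i. c (p' (p i))" "\<lambda>i. b (p i)"] p'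
    by simp
  have "int_independent J (\<lambda>i. b (p i))"
    unfolding int_independent_def
  proof (intro allI impI ballI)
    fix c i assume "lin_comb J c (\<lambda>i. b (p i)) = 0" and i: "i \<in> J"
    hence "\<forall>i\<in>J. c (p' i) = 0" "p i \<in> J"
      using assms by (auto simp: eq int_basis_iff int_independent_def bij_betw_def)
    thus "c i = 0" using p'[OF i] by metis
  qed
  moreover have "int_span J (\<lambda>i. b (p i)) = int_span J b"
  proof
    show "int_span J (\<lambda>i. b (p i)) \<subseteq> int_span J b" by (auto simp: int_span_def eq)
    show "int_span J b \<subseteq> int_span J (\<lambda>i. b (p i))"
      unfolding int_span_def
    proof (rule image_subsetI)
      show "lin_comb J c b \<in> range (\<lambda>c. lin_comb J c (\<lambda>i. b (p i)))" for c
        by (rule range_eqI[of _ _ "\<lambda>i. c (p i)"]) (simp add: lin_comb_permute[OF assms(1)])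
    qed
  qed
  ultimately show ?thesis using assms(2) by (simp add: int_basis_iff)
qed

text \<open>The pivot step of the Smith normal form, without matrices. Let \<open>d\<close> be the least positive coefficient
  with which any element of \<open>L\<close> can be written in any basis of \<open>M\<close>. Division with remainder by \<open>d\<close>
  and a change of basis turn remainders into coefficients of elements of \<open>L\<close>, which must vanish by
  minimality. The last conclusion follows by adding \<open>d *s b' k\<close> to the given element of \<open>L\<close>.\<close>

lemma ex_minimal_coefficient:
  fixes L :: "(int ^ 'm) set"
  assumes J: "finite J" "k \<notin> J" and b: "int_basis (insert k J) b M"
    and L: "sublattice L" and tors: "\<And>x. x \<in> M \<Longrightarrow> \<exists>c>0. c *s x \<in> L"
  obtains d b' where "d > 0" "int_basis (insert k J) b' M" "d *s b' k \<in> L"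
    "\<And>e. lin_comb (insert k J) e b' \<in> L \<Longrightarrow> d dvd e k"
    "\<And>e i. lin_comb J e b' \<in> L \<Longrightarrow> i \<in> J \<Longrightarrow> d dvd e i"
proof -
  let ?A = "insert k J"
  define S where "S = {a::nat. a > 0 \<and> (\<exists>b c. int_basis ?A b M \<and> lin_comb ?A c b \<in> L \<and> c k = int a)}"
  have fin: "finite ?A" using J by simp
  have "\<exists>a. a \<in> S"
  proof -
    have "b k \<in> M" using generator_in_int_span[OF fin, of k b] b by (auto simp: int_basis_iff)
    then obtain c where c: "c > 0" "c *s b k \<in> L" using tors by blast
    hence "lin_comb ?A (\<lambda>i. if i = k then c else 0) b \<in> L" by (simp add: lin_comb_single[OF fin])
    hence "nat c \<in> S" using c(1) b unfolding S_def by (auto intro!: exI[of _ b] exI[of _ "\<lambda>i. if i = k then c else 0"])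
    thus ?thesis by blast
  qed
  define d where "d = (LEAST a. a \<in> S)"
  have "d \<in> S" unfolding d_def using \<open>\<exists>a. a \<in> S\<close> by (rule LeastI_ex)
  then obtain b0 c where d: "d > 0" and b0: "int_basis ?A b0 M" and c: "lin_comb ?A c b0 \<in> L" "c k = int d"
    by (auto simp: S_def)
  have min: "c i = 0" if bb: "int_basis ?A bb M" and c: "lin_comb ?A c bb \<in> L" and i: "i \<in> ?A"
    and le: "0 \<le> c i" "c i < int d" for bb c i
  proof (rule ccontr)
    assume ne: "c i \<noteq> 0"
    \<comment> \<open>A coefficient at another index counts as well: exchange the two basis vectors.\<close>
    define p where "p = Transposition.transpose k i"
    have p: "bij_betw p ?A ?A" unfolding p_def using i by (simp add: bij_betw_transpose_iff)
    have "lin_comb ?A (\<lambda>i. c (p i)) (\<lambda>i. bb (p i)) \<in> L"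
      using c by (simp add: lin_comb_permute[OF p])
    moreover have "c (p k) = int (nat (c i))" using le by (simp add: p_def)
    ultimately have "nat (c i) \<in> S"
      using int_basis_permute[OF p bb] ne le unfolding S_def by auto
    hence "d \<le> nat (c i)" unfolding d_def by (rule Least_le)
    thus False using le d by simp
  qed
  have shear: "lin_comb ?A c bb = lin_comb ?A (\<lambda>i. if i = k then int d else c i mod int d)
      (bb(k := bb k + lin_comb J (\<lambda>i. c i div int d) bb))" if "c k = int d" for c bb
  proof -
    have "lin_comb J c bb = lin_comb J (\<lambda>i. int d * (c i div int d) + c i mod int d) bb" by simp
    also have "\<dots> = int d *s lin_comb J (\<lambda>i. c i div int d) bb + lin_comb J (\<lambda>i. c i mod int d) bb"
      by (simp only: lin_comb_add lin_comb_smult)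
    also have "lin_comb J (\<lambda>i. c i mod int d) bb = lin_comb J (\<lambda>i. if i = k then int d else c i mod int d)
        (bb(k := bb k + lin_comb J (\<lambda>i. c i div int d) bb))"
      using J(2) by (intro lin_comb_cong) auto
    finally show ?thesis
      using that by (simp add: lin_comb_insert[OF J] vector_add_ldistrib)
  qed
  have dvd: "int d dvd c i" if bb: "int_basis ?A bb M" and c: "lin_comb ?A c bb \<in> L" "c k = int d" and i: "i \<in> J"
    for bb c i
  proof -
    have "(if i = k then int d else c i mod int d) = 0"
      using c i J(2) d
      by (intro min[OF int_basis_shear[OF J bb lin_comb_in_int_span[of J "\<lambda>i. c i div int d"]]])
        (auto simp flip: shear[of c bb, OF c(2)])
    thus ?thesis using i J(2) by (auto split: if_splits)
  qed
  \<comment> \<open>In this basis the element of L realising the minimum is d times the k-th basis vector.\<close>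
  define b1 where "b1 = b0(k := b0 k + lin_comb J (\<lambda>i. c i div int d) b0)"
  have b1: "int_basis ?A b1 M" unfolding b1_def by (rule int_basis_shear[OF J b0 lin_comb_in_int_span])
  have "lin_comb ?A c b0 = lin_comb ?A (\<lambda>i. if i = k then int d else c i mod int d) b1"
    unfolding b1_def by (rule shear[of c b0, OF c(2)])
  also have "\<dots> = lin_comb ?A (\<lambda>i. if i = k then int d else 0) b1"
    using dvd[OF b0 c] by (intro lin_comb_cong) auto
  also have "\<dots> = int d *s b1 k" by (simp add: lin_comb_single[OF fin])
  finally have x: "int d *s b1 k \<in> L" using c(1) by simp
  show ?thesis
  proof (rule that[of "int d" b1])
    fix e assume e: "lin_comb ?A e b1 \<in> L"
    have "lin_comb ?A (\<lambda>i. e i - (e k div int d) * (if i = k then int d else 0)) b1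
        = lin_comb ?A e b1 - (e k div int d) *s (int d *s b1 k)"
      by (simp only: lin_comb_diff lin_comb_smult lin_comb_single[OF fin insertI1])
    also have "\<dots> \<in> L" by (rule sublattice_closed(2)[OF L e sublattice_smult[OF L x]])
    finally have "e k - (e k div int d) * (if k = k then int d else 0) = 0"
      using d by (intro min[OF b1]) (auto simp: minus_div_mult_eq_mod)
    thus "int d dvd e k" by (simp add: minus_div_mult_eq_mod dvd_eq_mod_eq_0)
  next
    fix e i assume e: "lin_comb J e b1 \<in> L" and i: "i \<in> J"
    have "lin_comb ?A (e(k := int d)) b1 = int d *s b1 k + lin_comb J e b1"
      using lin_comb_cong[of J "e(k := int d)" e b1 b1] J(2)
      by (simp add: lin_comb_insert[OF J]) (metis fun_upd_other)
    hence "lin_comb ?A (e(k := int d)) b1 \<in> L" using sublattice_closed(4)[OF L x e] by simp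
    moreover have "i \<noteq> k" using i J(2) by auto
    ultimately show "int d dvd e i" using dvd[OF b1 _ _ i, of "e(k := int d)"] by simp
  qed (use d b1 x in auto)
qed

text \<open>Split off the basis vector provided by the pivot step and induct on the intersection of \<open>L\<close> with the
  span of the others. The first factor divides the next one because that intersection is contained
  in \<open>d\<close> times the span. Torsion of the quotient guarantees that a pivot exists at every step, so all
  factors are positive.\<close>

lemma stacked_bases:
  fixes L :: "(int ^ 'm) set"
  assumes "int_basis {k..n} b M" "sublattice L" "L \<subseteq> M" "\<And>x. x \<in> M \<Longrightarrow> \<exists>c>0. c *s x \<in> L"
  shows "\<exists>d m. (\<forall>i\<in>{k..n}. (0::nat) < d i) \<and> (\<forall>i\<in>{k..<n}. d i dvd d (Suc i)) \<and>
      int_basis {k..n} m M \<and> int_basis {k..n} (\<lambda>i. int (d i) *s m i) L"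
  using assms
proof (induction "Suc n - k" arbitrary: k b M L)
  case 0
  hence "{k..n} = {}" by simp
  hence eq: "int_span {k..n} m = {0}" "int_independent {k..n} m" for m :: "nat \<Rightarrow> int ^ 'm"
    by (auto simp: int_span_def lin_comb_def int_independent_def)
  have "M = {0}" using 0 eq by (simp add: int_basis_iff)
  hence "L = {0}" using 0 sublattice_closed(1) by blast
  show ?case using eq \<open>M = {0}\<close> \<open>L = {0}\<close> \<open>{k..n} = {}\<close> by (auto simp: int_basis_iff)
next
  case (Suc l)
  let ?J = "{Suc k..n}"
  have A: "{k..n} = insert k ?J" and J: "finite ?J" "k \<notin> ?J" using Suc(2) by auto
  obtain d b' where d: "d > 0" and b': "int_basis (insert k ?J) b' M" and x: "d *s b' k \<in> L"
    and dvd: "\<And>e. lin_comb (insert k ?J) e b' \<in> L \<Longrightarrow> d dvd e k"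
      "\<And>e i. lin_comb ?J e b' \<in> L \<Longrightarrow> i \<in> ?J \<Longrightarrow> d dvd e i"
    using ex_minimal_coefficient[OF J, of b M L] Suc.prems unfolding A by metis
  define M' where "M' = int_span ?J b'"
  have ind: "int_independent ?J b'" using int_independent_insertD(1)[OF J, of b'] b' by (simp add: int_basis_iff)
  have M: "M = {q *s b' k + z | q z. z \<in> M'}"
    using b' int_span_insert[OF J, of b'] by (simp add: int_basis_iff M'_def)
  hence "M' \<subseteq> M" by (force intro: exI[of _ 0])
  note L = \<open>sublattice L\<close>
  have L': "sublattice (L \<inter> M')"
    using sublattice_closed[OF L] by (auto simp: sublattice_def M'_def intro: int_span_closed)
  have tors: "\<exists>c>0. c *s x \<in> L \<inter> M'" if "x \<in> M'" for x
    using Suc.prems(4)[of x] that \<open>M' \<subseteq> M\<close> by (auto simp: M'_def intro: int_span_closed)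
  have "l = Suc n - Suc k" using Suc(2) by simp
  moreover have "int_basis ?J b' M'" using ind by (simp add: int_basis_iff M'_def)
  ultimately have "\<exists>d m. (\<forall>i\<in>?J. (0::nat) < d i) \<and> (\<forall>i\<in>{Suc k..<n}. d i dvd d (Suc i)) \<and>
      int_basis ?J m M' \<and> int_basis ?J (\<lambda>i. int (d i) *s m i) (L \<inter> M')"
    by (rule Suc.hyps(1)[OF _ _ L' _ tors]) auto
  then obtain d' m' where
    d': "\<And>i. i \<in> ?J \<Longrightarrow> 0 < d' i" "\<And>i. i \<in> {Suc k..<n} \<Longrightarrow> d' i dvd d' (Suc i)" and
    m': "int_basis ?J m' M'" "int_basis ?J (\<lambda>i. int (d' i) *s m' i) (L \<inter> M')"
    by blast
  define d'' where "d'' = d'(k := nat d)"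
  define m where "m = m'(k := b' k)"
  have m_eq: "m i = m' i" "d'' i = d' i" if "i \<in> ?J" for i using that by (auto simp: m_def d''_def)
  have mJ: "int_basis ?J m M'" "int_basis ?J (\<lambda>i. int (d'' i) *s m i) (L \<inter> M')"
    using m' m_eq int_span_cong[of ?J m m'] int_independent_cong[of ?J m m']
      int_span_cong[of ?J "\<lambda>i. int (d'' i) *s m i" "\<lambda>i. int (d' i) *s m' i"]
      int_independent_cong[of ?J "\<lambda>i. int (d'' i) *s m i" "\<lambda>i. int (d' i) *s m' i"]
    by (simp_all add: int_basis_iff)
  have mM: "int_basis (insert k ?J) m M"
    using mJ(1) by (intro int_basis_replace[OF J b', of m 0])
      (auto simp: M'_def m_def intro: int_span_closed generator_in_int_span)
  have dk: "int (d'' k) = d" "m k = b' k" using d by (simp_all add: d''_def m_def)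
  have "int_independent (insert k ?J) (\<lambda>i. int (d'' i) *s m i)"
    unfolding int_independent_def lin_comb_scale
  proof (intro allI impI ballI)
    fix c i assume "lin_comb (insert k ?J) (\<lambda>i. c i * int (d'' i)) m = 0" and i: "i \<in> insert k ?J"
    hence "c i * int (d'' i) = 0"
      using mM[unfolded int_basis_iff int_independent_def, THEN conjunct1, THEN spec, of "\<lambda>i. c i * int (d'' i)"]
      by blast
    moreover have "d'' i > 0" using i d d'(1) m_eq dk by (cases "i = k") (auto simp: d''_def)
    ultimately show "c i = 0" by simp
  qed
  moreover have "int_span (insert k ?J) (\<lambda>i. int (d'' i) *s m i) = L"
    unfolding int_span_insert[OF J] dk
  proof (intro equalityI subsetI; clarify?)
    fix q z assume "z \<in> int_span ?J (\<lambda>i. int (d'' i) *s m i)"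
    hence "z \<in> L" using mJ(2) by (auto simp: int_basis_iff)
    thus "q *s (d *s b' k) + z \<in> L" by (rule sublattice_closed(4)[OF L sublattice_smult[OF L x]])
  next
    fix y assume y: "y \<in> L"
    hence "y \<in> int_span (insert k ?J) b'" using b' Suc.prems(3) by (auto simp: int_basis_iff)
    then obtain e where e: "y = lin_comb (insert k ?J) e b'" by (auto simp: int_span_def)
    then obtain q where q: "e k = d * q" using dvd(1) y by blast
    have "y = q *s (d *s b' k) + lin_comb ?J e b'"
      by (simp add: e q lin_comb_insert[OF J] vector_smult_assoc mult.commute)
    moreover from this have "lin_comb ?J e b' = y - q *s (d *s b' k)" by simp
    hence "lin_comb ?J e b' \<in> L"
      using sublattice_closed(2)[OF L y sublattice_smult[OF L x]] by metis
    hence "lin_comb ?J e b' \<in> L \<inter> M'" by (simp add: M'_def)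
    hence "lin_comb ?J e b' \<in> int_span ?J (\<lambda>i. int (d'' i) *s m i)" using mJ(2) by (simp add: int_basis_iff)
    ultimately show "\<exists>q z. y = q *s (d *s b' k) + z \<and> z \<in> int_span ?J (\<lambda>i. int (d'' i) *s m i)" by blast
  qed
  moreover have "d'' i dvd d'' (Suc i)" if i: "i \<in> {k..<n}" for i
  proof (cases "i = k")
    case True
    \<comment> \<open>All coordinates of ?y in b' are divisible by d, hence so are its coordinates in m'.\<close>
    let ?y = "int (d' (Suc k)) *s m' (Suc k)"
    have S: "Suc k \<in> ?J" using i True by simp
    have y: "?y \<in> L \<inter> M'"
      using generator_in_int_span[OF J(1) S, of "\<lambda>i. int (d' i) *s m' i"] m'(2) by (auto simp: int_basis_iff)
    then obtain e where e: "?y = lin_comb ?J e b'" by (auto simp: M'_def int_span_def)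
    have "?y = lin_comb ?J (\<lambda>i. d * (e i div d)) b'"
      using dvd(2)[of e] y unfolding e by (intro lin_comb_cong) auto
    also have "\<dots> = d *s lin_comb ?J (\<lambda>i. e i div d) b'" by (rule lin_comb_smult)
    finally obtain z where z: "?y = d *s z" "z \<in> M'" by (auto simp: M'_def)
    then obtain g where "z = lin_comb ?J g m'" using m'(1) by (auto simp: int_basis_iff int_span_def)
    hence "lin_comb ?J (\<lambda>i. d * g i) m' = lin_comb ?J (\<lambda>i. if i = Suc k then int (d' (Suc k)) else 0) m'"
      using z(1) by (simp add: lin_comb_smult lin_comb_single[OF J(1) S])
    moreover have "int_independent ?J m'" using m'(1) by (simp only: int_basis_iff)
    ultimately have "\<forall>i\<in>?J. d * g i = (if i = Suc k then int (d' (Suc k)) else 0)"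
      by (simp only: lin_comb_eq_iff)
    from bspec[OF this S] have "d * g (Suc k) = int (d' (Suc k))" by simp
    hence "int (d'' k) dvd int (d'' (Suc k))" unfolding dk m_eq(2)[OF S] by (metis dvd_triv_left)
    thus ?thesis using True by simp
  next
    case False
    thus ?thesis using i d'(2)[of i] m_eq(2)[of i] m_eq(2)[of "Suc i"] by auto
  qed
  moreover have "0 < d'' i" if "i \<in> insert k ?J" for i
    using that d d'(1) by (auto simp: d''_def)
  ultimately show ?case unfolding A
    using mM by (intro exI[of _ d''] exI[of _ m]) (simp add: int_basis_iff flip: A)
qed

lemma quotient_group_eq:
  assumes "sublattice L" "sublattice M" "L \<subseteq> M"
  shows "quotient_group M L = (\<lambda>x. x +o L) ` M"
proof -
  have "{(x, y). x \<in> M \<and> y \<in> M \<and> x - y \<in> L} `` {x} = x +o L" if x: "x \<in> M" for x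
  proof -
    have "y \<in> M" if "y - x \<in> L" for y
      using sublattice_closed(4)[OF assms(2), of "y - x" x] that x assms(3) by auto
    moreover have "x - y \<in> L \<longleftrightarrow> y - x \<in> L" for y
      using sublattice_closed(3)[OF assms(1)] by (metis minus_diff_eq)
    ultimately show ?thesis using x by (auto simp flip: set_minus_plus)
  qed
  thus ?thesis by (auto simp: quotient_group_def quotient_def)
qed

text \<open>Relative to stacked bases, residues modulo \<open>d i\<close> in each coordinate represent the cosets.\<close>

lemma card_quotient_group:
  fixes M L :: "(int ^ 'm) set" and d :: "nat \<Rightarrow> nat"
  assumes M: "int_basis {1..n} m M" and L: "int_basis {1..n} (\<lambda>i. int (d i) *s m i) L"
    and d: "\<And>i. i \<in> {1..n} \<Longrightarrow> 0 < d i" and sub: "sublattice L" "sublattice M" "L \<subseteq> M"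
  shows "finite (quotient_group M L)" "card (quotient_group M L) = (\<Prod>i=1..n. d i)"
proof -
  let ?J = "{1..n}"
  let ?P = "PiE ?J (\<lambda>i. {0..<d i})"
  let ?h = "\<lambda>c. lin_comb ?J (\<lambda>i. int (c i)) m +o L"
  have ind: "int_independent ?J m" and spanM: "int_span ?J m = M"
    and spanL: "int_span ?J (\<lambda>i. int (d i) *s m i) = L"
    using M L by (auto simp: int_basis_iff)
  have "bij_betw ?h ?P (quotient_group M L)"
    unfolding quotient_group_eq[OF sub] bij_betw_def
  proof
    show "inj_on ?h ?P"
    proof (rule inj_onI)
      fix c e assume c: "c \<in> ?P" and e: "e \<in> ?P" and "?h c = ?h e"
      hence "lin_comb ?J (\<lambda>i. int (c i) - int (e i)) m \<in> L"
        by (simp add: translate_eq_iff[OF sub(1)] lin_comb_diff)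
      then obtain f where "lin_comb ?J (\<lambda>i. int (c i) - int (e i)) m = lin_comb ?J (\<lambda>i. f i * int (d i)) m"
        unfolding spanL[symmetric] by (auto simp: int_span_def lin_comb_scale)
      hence eq: "\<forall>i\<in>?J. int (c i) - int (e i) = f i * int (d i)" by (simp only: lin_comb_eq_iff[OF ind])
      show "c = e"
      proof (rule PiE_ext[OF c e])
        fix i assume i: "i \<in> ?J"
        hence "int (c i) mod int (d i) = int (e i) mod int (d i)"
          using eq by (simp add: mod_eq_dvd_iff)
        moreover have "c i < d i" "e i < d i" using c e i by auto
        ultimately show "c i = e i" by simp
      qed
    qed
    show "?h ` ?P = (\<lambda>x. x +o L) ` M"
    proof (intro equalityI image_subsetI)
      show "?h c \<in> (\<lambda>x. x +o L) ` M" if "c \<in> ?P" for c by (simp flip: spanM)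
    next
      fix x assume "x \<in> M"
      then obtain c where c: "x = lin_comb ?J c m" unfolding spanM[symmetric] by (auto simp: int_span_def)
      define e where "e = restrict (\<lambda>i. nat (c i mod int (d i))) ?J"
      have e: "int (e i) = c i mod int (d i)" "e i < d i" if "i \<in> ?J" for i
        using that d[OF that] by (auto simp: e_def nat_less_iff)
      have "x - lin_comb ?J (\<lambda>i. int (e i)) m = lin_comb ?J (\<lambda>i. c i - int (e i)) m"
        by (simp add: c lin_comb_diff)
      also have "\<dots> = lin_comb ?J (\<lambda>i. (c i div int (d i)) * int (d i)) m"
        using e(1) by (intro lin_comb_cong) (auto simp: minus_mod_eq_div_mult)
      also have "\<dots> \<in> L" unfolding spanL[symmetric] lin_comb_scale[symmetric] by simp
      finally have "x +o L = ?h e" by (simp add: translate_eq_iff[OF sub(1)])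
      moreover have "e \<in> ?P" using e(2) by (auto simp: e_def)
      ultimately show "x +o L \<in> ?h ` ?P" by blast
    qed
  qed
  note bij = bij_betw_finite[OF this] bij_betw_same_card[OF this]
  show "finite (quotient_group M L)" using bij(1) by (simp add: finite_PiE)
  show "card (quotient_group M L) = (\<Prod>i=1..n. d i)" using bij(2) by (simp add: card_PiE)
qed

section \<open>Uniqueness of the Hilbert polynomial\<close>

lemma poly_eq_0_if_zero_on_large_nats:
  fixes p :: "rat poly"
  assumes "\<And>k::nat. k0 \<le> k \<Longrightarrow> poly p (of_nat k) = 0"
  shows "p = 0"
proof (rule ccontr)
  assume "p \<noteq> 0"
  hence "finite {x. poly p x = 0}" by (rule poly_roots_finite)
  moreover have "of_nat ` {k0..} \<subseteq> {x. poly p x = 0}" using assms by auto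
  ultimately have "finite (of_nat ` {k0..} :: rat set)" by (rule rev_finite_subset)
  hence "finite {k0..}" by (rule finite_imageD) (simp add: inj_on_def)
  thus False by (simp add: infinite_Ici)
qed

text \<open>Induction over the variables: with all other variables fixed, the expression is a univariate
  polynomial in the new one that has infinitely many zeros, so each of its coefficients vanishes
  identically in the other variables. Leaving out variables merges exponents that agree on \<open>T\<close>,
  which is why the conclusion is about sums of coefficients.\<close>

lemma sum_coefficients_eq_0:
  fixes c :: "('d \<Rightarrow>\<^sub>0 nat) \<Rightarrow> rat"
  assumes "finite T" "finite S"
    and "\<And>x :: 'd \<Rightarrow> int. (\<Sum>u\<in>S. c u * (\<Prod>i\<in>T. of_int (x i) ^ Poly_Mapping.lookup u i)) = 0"
  shows "(\<Sum>u | u \<in> S \<and> (\<forall>i\<in>T. Poly_Mapping.lookup u i = w i). c u) = 0"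
  using assms
proof (induction T arbitrary: S rule: finite_induct)
  case empty
  thus ?case by simp
next
  case (insert j T)
  let ?S = "{u\<in>S. Poly_Mapping.lookup u j = w j}"
  have "(\<Sum>u\<in>?S. c u * (\<Prod>i\<in>T. of_int (x i) ^ Poly_Mapping.lookup u i)) = 0" for x :: "'d \<Rightarrow> int"
  proof -
    let ?m = "\<lambda>u. c u * (\<Prod>i\<in>T. of_int (x i) ^ Poly_Mapping.lookup u i)"
    define p where "p = (\<Sum>u\<in>S. Polynomial.monom (?m u) (Poly_Mapping.lookup u j))"
    have "poly p (of_nat k) = 0" for k :: nat
    proof -
      have "poly p (of_nat k) = (\<Sum>u\<in>S. ?m u * of_nat k ^ Poly_Mapping.lookup u j)"
        by (simp add: p_def poly_sum poly_monom)
      also have "\<dots> = (\<Sum>u\<in>S. c u * (\<Prod>i\<in>insert j T. of_int ((x(j := int k)) i) ^ Poly_Mapping.lookup u i))"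
      proof (rule sum.cong[OF refl])
        fix u assume "u \<in> S"
        have "(\<Prod>i\<in>T. of_int ((x(j := int k)) i) ^ Poly_Mapping.lookup u i :: rat)
            = (\<Prod>i\<in>T. of_int (x i) ^ Poly_Mapping.lookup u i)"
          using insert.hyps(2) by (intro prod.cong) auto
        thus "?m u * of_nat k ^ Poly_Mapping.lookup u j
            = c u * (\<Prod>i\<in>insert j T. of_int ((x(j := int k)) i) ^ Poly_Mapping.lookup u i)"
          using insert.hyps by simp
      qed
      also have "\<dots> = 0" by (rule insert.prems(2))
      finally show ?thesis .
    qed
    hence "p = 0" by (intro poly_eq_0_if_zero_on_large_nats)
    hence "Polynomial.coeff p (w j) = 0" by simp
    moreover have "Polynomial.coeff p (w j) = (\<Sum>u\<in>?S. ?m u)"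
      by (simp add: p_def coeff_sum coeff_monom sum.If_cases[OF insert.prems(1)] Int_def)
    ultimately show ?thesis by simp
  qed
  from insert.IH[OF _ this] insert.prems(1)
  have "(\<Sum>u | u \<in> ?S \<and> (\<forall>i\<in>T. Poly_Mapping.lookup u i = w i). c u) = 0" by simp
  moreover have "{u. u \<in> ?S \<and> (\<forall>i\<in>T. Poly_Mapping.lookup u i = w i)}
      = {u. u \<in> S \<and> (\<forall>i\<in>insert j T. Poly_Mapping.lookup u i = w i)}" by auto
  ultimately show ?case by simp
qed

lemma eval_mpoly_superset:
  assumes "finite A" "Poly_Mapping.keys P \<subseteq> A"
  shows "eval_mpoly P \<alpha> = (\<Sum>u\<in>A. Poly_Mapping.lookup P u * (\<Prod>i\<in>UNIV. of_int (\<alpha> $ i) ^ Poly_Mapping.lookup u i))"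
  unfolding eval_mpoly_def using assms by (intro sum.mono_neutral_left) (auto simp: in_keys_iff)

lemma eval_mpoly_diff: "eval_mpoly (P - Q) \<alpha> = eval_mpoly P \<alpha> - eval_mpoly Q \<alpha>"
proof -
  let ?A = "Poly_Mapping.keys P \<union> Poly_Mapping.keys Q"
  have "eval_mpoly R \<alpha> = (\<Sum>u\<in>?A. Poly_Mapping.lookup R u * (\<Prod>i\<in>UNIV. of_int (\<alpha> $ i) ^ Poly_Mapping.lookup u i))"
    if "R \<in> {P, Q, P - Q}" for R
    using that by (intro eval_mpoly_superset) (auto simp: in_keys_iff lookup_minus)
  thus ?thesis by (simp add: lookup_minus sum_subtractf left_diff_distrib)
qed

lemma eval_mpoly_single [simp]: "eval_mpoly (Poly_Mapping.single 0 c) \<alpha> = c"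
  by (simp add: eval_mpoly_def)

lemma eval_mpoly_eq_0_imp:
  fixes P :: "('d::finite, rat) mpoly"
  assumes "\<And>\<alpha>. eval_mpoly P \<alpha> = 0"
  shows "P = 0"
proof (rule poly_mapping_eqI)
  fix w
  have "(\<Sum>u\<in>Poly_Mapping.keys P. Poly_Mapping.lookup P u * (\<Prod>i\<in>UNIV. of_int (x i) ^ Poly_Mapping.lookup u i)) = 0"
    for x :: "'d \<Rightarrow> int"
    using assms[of "\<chi> i. x i"] by (simp add: eval_mpoly_def)
  from sum_coefficients_eq_0[OF _ _ this, of "Poly_Mapping.lookup w"]
  have "(\<Sum>u | u \<in> Poly_Mapping.keys P \<and> (\<forall>i\<in>UNIV. Poly_Mapping.lookup u i = Poly_Mapping.lookup w i).
      Poly_Mapping.lookup P u) = 0" by simp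
  moreover have "{u. u \<in> Poly_Mapping.keys P \<and> (\<forall>i\<in>UNIV. Poly_Mapping.lookup u i = Poly_Mapping.lookup w i)}
      = (if w \<in> Poly_Mapping.keys P then {w} else {})"
  proof -
    have "(\<forall>i\<in>UNIV. Poly_Mapping.lookup u i = Poly_Mapping.lookup w i) \<longleftrightarrow> u = w" for u
      by (auto intro: poly_mapping_eqI)
    thus ?thesis by auto
  qed
  ultimately show "Poly_Mapping.lookup P w = Poly_Mapping.lookup 0 w"
    by (auto simp: in_keys_iff split: if_splits)
qed

text \<open>Along a line the polynomial becomes univariate, so zeros far out on the line propagate back to
  its base point \<open>e\<close>.\<close>

lemma eval_mpoly_zero_on_line:
  fixes a e :: "int ^ 'd::finite"
  assumes "\<And>k::nat. k0 \<le> k \<Longrightarrow> eval_mpoly P (int k *s a + e) = 0"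
  shows "eval_mpoly P e = 0"
proof -
  define p where "p = (\<Sum>u\<in>Poly_Mapping.keys P. Polynomial.smult (Poly_Mapping.lookup P u)
    (\<Prod>i\<in>UNIV. [:of_int (e $ i), of_int (a $ i):] ^ Poly_Mapping.lookup u i))"
  have eval: "poly p (of_nat k) = eval_mpoly P (int k *s a + e)" for k :: nat
    by (simp add: p_def poly_sum poly_prod eval_mpoly_def algebra_simps)
  hence "p = 0" using assms by (intro poly_eq_0_if_zero_on_large_nats[of k0]) simp
  thus ?thesis using eval[of 0] by simp
qed

text \<open>The difference of two candidates vanishes at every degree deep inside both translates of the nef
  semigroup. Each line in the direction of the ample class \<open>a\<close> ends up there, so the difference
  vanishes at every base point, that is, on all of \<open>\<int>\<^sup>d\<close>.\<close>

lemma hilbert_polynomial_unique: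
  assumes ample: "\<And>e. \<exists>k0. \<forall>k\<ge>k0. int k *s a + e \<in> nef_semigroup v \<Sigma> \<beta>"
    and P: "is_hilbert_polynomial v \<Sigma> \<beta> I P" and Q: "is_hilbert_polynomial v \<Sigma> \<beta> I Q"
  shows "P = Q"
proof -
  obtain \<gamma> \<delta> where
    \<gamma>: "\<And>\<alpha>. \<alpha> \<in> nef_semigroup v \<Sigma> \<beta> \<Longrightarrow> eval_mpoly P (\<gamma> + \<alpha>) = of_nat (hilbert_function \<beta> I (\<gamma> + \<alpha>))" and
    \<delta>: "\<And>\<alpha>. \<alpha> \<in> nef_semigroup v \<Sigma> \<beta> \<Longrightarrow> eval_mpoly Q (\<delta> + \<alpha>) = of_nat (hilbert_function \<beta> I (\<delta> + \<alpha>))"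
    using P Q by (auto simp: is_hilbert_polynomial_def)
  have "eval_mpoly (P - Q) e = 0" for e
  proof -
    obtain k1 k2 where k: "\<And>k. k \<ge> k1 \<Longrightarrow> int k *s a + (e - \<gamma>) \<in> nef_semigroup v \<Sigma> \<beta>"
        "\<And>k. k \<ge> k2 \<Longrightarrow> int k *s a + (e - \<delta>) \<in> nef_semigroup v \<Sigma> \<beta>"
      using ample by metis
    show ?thesis
    proof (rule eval_mpoly_zero_on_line[of "max k1 k2"])
      fix k assume "max k1 k2 \<le> k"
      thus "eval_mpoly (P - Q) (int k *s a + e) = 0"
        using \<gamma>[OF k(1)[of k]] \<delta>[OF k(2)[of k]] by (simp add: eval_mpoly_diff algebra_simps)
    qed
  qed
  hence "P - Q = 0" by (rule eval_mpoly_eq_0_imp)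
  thus ?thesis by simp
qed

section \<open>An ample class from the lattice polytope\<close>

definition int_dot :: "int ^ 'n \<Rightarrow> int ^ 'n \<Rightarrow> int" where
  "int_dot x y = (\<Sum>j\<in>UNIV. x $ j * y $ j)"

lemma int_dot_commute: "int_dot x y = int_dot y x"
  by (simp add: int_dot_def mult.commute)

lemma int_dot_lin_comb: "int_dot x (lin_comb J c b) = (\<Sum>k\<in>J. c k * int_dot x (b k))"
  by (simp add: int_dot_def lin_comb_def sum_distrib_left) (subst sum.swap, simp add: algebra_simps)

lemma inner_real_vec: "real_vec x \<bullet> real_vec y = real_of_int (int_dot x y)"
  by (simp add: real_vec_def inner_vec_def int_dot_def)

lemma real_vec_simps:
  "real_vec (x + y) = real_vec x + real_vec y" "real_vec (c *s x) = real_of_int c *\<^sub>R real_vec x"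
  "real_vec x = real_vec y \<longleftrightarrow> x = y" "real_vec 0 = 0"
  by (simp_all add: real_vec_def vec_eq_iff)

lemma ray_matrix_mult: "(ray_matrix v *v m) $ i = int_dot (v i) m"
  by (simp add: ray_matrix_def matrix_vector_mult_def int_dot_def)

text \<open>The coordinates with respect to \<open>b\<close> are additive functions to the integers, hence given by pairing
  with integral vectors.\<close>

lemma dual_basis:
  fixes b :: "'n::finite \<Rightarrow> int ^ 'n"
  assumes "int_basis UNIV b UNIV"
  obtains b' where "\<And>x. x = lin_comb UNIV (\<lambda>k. int_dot x (b' k)) b"
    "\<And>k l. int_dot (b l) (b' k) = (if k = l then 1 else 0)"
proof -
  have ind: "int_independent UNIV b" and span: "int_span UNIV b = UNIV"
    using assms by (simp_all add: int_basis_iff)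
  \<comment> \<open>The dual vectors collect the coordinates of the standard basis vectors.\<close>
  have "\<forall>j. \<exists>c. axis j 1 = lin_comb UNIV c b"
    using span by (auto simp: int_span_def)
  then obtain C where C: "\<And>j. axis j 1 = lin_comb UNIV (C j) b" by (auto dest: choice)
  define b' where "b' k = (\<chi> j. C j k)" for k
  have 1: "x = lin_comb UNIV (\<lambda>k. int_dot x (b' k)) b" for x
  proof -
    have "x = (\<Sum>j\<in>UNIV. x $ j *s axis j 1)"
      by (simp add: vec_eq_iff axis_def if_distrib cong: if_cong)
    also have "\<dots> = (\<Sum>j\<in>UNIV. \<Sum>k\<in>UNIV. (x $ j * C j k) *s b k)"
      by (simp add: C lin_comb_def vec_eq_iff sum_distrib_left algebra_simps)
    also have "\<dots> = lin_comb UNIV (\<lambda>k. int_dot x (b' k)) b"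
      by (subst sum.swap) (simp add: lin_comb_def int_dot_def b'_def vec_eq_iff sum_distrib_right)
    finally show ?thesis .
  qed
  have "lin_comb UNIV (\<lambda>k. if k = l then 1 else 0) b = b l" for l
    using lin_comb_single[of UNIV l 1 b] by simp
  hence "lin_comb UNIV (\<lambda>k. if k = l then 1 else 0) b = lin_comb UNIV (\<lambda>k. int_dot (b l) (b' k)) b" for l
    using 1[of "b l"] by simp
  hence "int_dot (b l) (b' k) = (if k = l then 1 else 0)" for k l
    unfolding lin_comb_eq_iff[OF ind] by simp
  with 1 show ?thesis using that by blast
qed

lemma real_vec_in_ray: "real_vec u \<in> ray u"
  unfolding ray_def by (rule hull_inc) simp

lemma rayE:
  assumes "x \<in> ray u"
  obtains t where "t \<ge> 0" "x = t *\<^sub>R real_vec u"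
proof -
  have "convex_cone {t *\<^sub>R real_vec u | t. t \<ge> 0}"
    unfolding convex_cone_iff
  proof (intro conjI ballI allI impI)
    show "0 \<in> {t *\<^sub>R real_vec u | t. t \<ge> 0}" by (auto intro!: exI[of _ 0])
    show "x + y \<in> {t *\<^sub>R real_vec u | t. t \<ge> 0}"
      if xy: "x \<in> {t *\<^sub>R real_vec u | t. t \<ge> 0}" "y \<in> {t *\<^sub>R real_vec u | t. t \<ge> 0}" for x y
    proof -
      obtain s t where "x = s *\<^sub>R real_vec u" "y = t *\<^sub>R real_vec u" "s \<ge> 0" "t \<ge> 0" using xy by auto
      thus ?thesis by (auto simp: scaleR_left_distrib intro!: exI[of _ "s + t"])
    qed
    show "c *\<^sub>R x \<in> {t *\<^sub>R real_vec u | t. t \<ge> 0}"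
      if "x \<in> {t *\<^sub>R real_vec u | t. t \<ge> 0}" "c \<ge> 0" for x c
      using that by (auto intro!: mult_nonneg_nonneg)
  qed
  moreover have "{real_vec u} \<subseteq> {t *\<^sub>R real_vec u | t. t \<ge> 0}" by (auto intro!: exI[of _ 1])
  ultimately have "ray u \<subseteq> {t *\<^sub>R real_vec u | t. t \<ge> 0}"
    unfolding ray_def by (intro hull_minimal) auto
  thus ?thesis using assms that by blast
qed

text \<open>Pick a coordinate \<open>j\<close> with positive coefficient in the expansion of \<open>u\<close>. As \<open>u\<close> is the midpoint of
  twice the \<open>j\<close>-th term and twice the sum of the other terms, both in the cone, the face property
  puts the \<open>j\<close>-th term on the ray of \<open>u\<close>. Comparing the \<open>j\<close>-th coordinates makes it equal to \<open>u\<close>,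
  and primitivity then forces the coefficient to be \<open>1\<close>.\<close>

lemma ray_in_smooth_cone:
  fixes b b' :: "'n::finite \<Rightarrow> int ^ 'n"
  assumes dual: "\<And>x. x = lin_comb UNIV (\<lambda>k. int_dot x (b' k)) b"
      "\<And>k l. int_dot (b l) (b' k) = (if k = l then 1 else 0)"
    and \<sigma>: "\<sigma> = convex_cone hull (real_vec ` b ` J)"
    and u: "primitive_vec u" "ray u face_of \<sigma>"
  shows "\<exists>j. u = b j"
proof -
  define c where "c k = int_dot u (b' k)" for k
  have "convex_cone {x. \<forall>k. 0 \<le> x \<bullet> real_vec (b' k) \<and> (k \<notin> J \<longrightarrow> x \<bullet> real_vec (b' k) = 0)}"
    by (auto simp: convex_cone_iff inner_add_left)
  moreover have "real_vec ` b ` J \<subseteq> {x. \<forall>k. 0 \<le> x \<bullet> real_vec (b' k) \<and> (k \<notin> J \<longrightarrow> x \<bullet> real_vec (b' k) = 0)}"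
    by (auto simp: inner_real_vec dual(2))
  ultimately have sub: "\<sigma> \<subseteq> {x. \<forall>k. 0 \<le> x \<bullet> real_vec (b' k) \<and> (k \<notin> J \<longrightarrow> x \<bullet> real_vec (b' k) = 0)}"
    unfolding \<sigma> by (intro hull_minimal) auto
  have "real_vec u \<in> \<sigma>" using u(2) real_vec_in_ray face_of_imp_subset by blast
  hence c: "0 \<le> c k" "k \<notin> J \<Longrightarrow> c k = 0" for k
    using sub by (auto simp: inner_real_vec c_def)
  have cone: "convex_cone \<sigma>" unfolding \<sigma> by (rule convex_cone_convex_cone_hull)
  have gen: "real_vec (a *s b k) \<in> \<sigma>" if "k \<in> J" "0 \<le> a" for a k
    unfolding real_vec_simps using that
    by (intro convex_cone_scaleR[OF cone]) (auto simp: \<sigma> intro: hull_inc)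
  have gens: "real_vec (lin_comb A (\<lambda>k. a k) b) \<in> \<sigma>"
    if "finite A" "\<And>k. 0 \<le> a k" "\<And>k. k \<notin> J \<Longrightarrow> a k = 0" for A a
    using that(1)
  proof (induction A rule: finite_induct)
    case empty
    show ?case using convex_cone_contains_0[OF cone] by (simp add: lin_comb_def real_vec_simps)
  next
    case (insert k A)
    have "real_vec (a k *s b k) \<in> \<sigma>"
      using gen[of k "a k"] that(2,3)[of k] convex_cone_contains_0[OF cone]
      by (cases "k \<in> J") (auto simp: real_vec_simps)
    thus ?case using insert convex_cone_add[OF cone] by (simp add: lin_comb_insert real_vec_simps(1))
  qed
  have expand: "u = lin_comb UNIV c b" unfolding c_def by (rule dual(1))
  have "u \<noteq> 0" using u(1) by (auto simp: primitive_vec_def)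
  have "\<exists>j. c j \<noteq> 0"
  proof (rule ccontr)
    assume "\<nexists>j. c j \<noteq> 0"
    hence "lin_comb UNIV c b = 0" by (simp add: lin_comb_def)
    thus False using expand \<open>u \<noteq> 0\<close> by simp
  qed
  then obtain j where j: "c j \<noteq> 0" by blast
  hence "j \<in> J" "c j > 0" using c[of j] by auto
  define y where "y = lin_comb (UNIV - {j}) c b"
  have u_split: "u = c j *s b j + y"
    using lin_comb_insert[of "UNIV - {j}" j c b] by (simp add: expand y_def insert_UNIV)
  have "int_dot y (b' j) = (\<Sum>k\<in>UNIV - {j}. c k * int_dot (b' j) (b k))"
    unfolding y_def int_dot_commute[of _ "b' j"] int_dot_lin_comb ..
  also have "\<dots> = 0" by (intro sum.neutral) (simp add: int_dot_commute[of "b' j"] dual(2))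
  finally have yj: "int_dot y (b' j) = 0" .
  let ?x1 = "2 *\<^sub>R real_vec (c j *s b j)" and ?x2 = "2 *\<^sub>R real_vec y"
  have j1: "?x1 \<bullet> real_vec (b' j) = 2 * real_of_int (c j)" "?x2 \<bullet> real_vec (b' j) = 0"
    by (simp_all add: real_vec_simps inner_real_vec dual(2) yj)
  have "?x1 \<noteq> ?x2"
  proof
    assume "?x1 = ?x2"
    hence "?x1 \<bullet> real_vec (b' j) = ?x2 \<bullet> real_vec (b' j)" by simp
    thus False unfolding j1 using \<open>c j > 0\<close> by simp
  qed
  moreover have "midpoint ?x1 ?x2 = real_vec u"
    by (subst u_split) (simp add: midpoint_def real_vec_simps(1) scaleR_right_distrib)
  ultimately have "real_vec u \<in> open_segment ?x1 ?x2" by (metis midpoint_in_open_segment)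
  moreover have "?x1 \<in> \<sigma>" "?x2 \<in> \<sigma>"
    using gen[of j "c j"] gens[of "UNIV - {j}" c] c \<open>j \<in> J\<close>
    by (auto simp: y_def intro!: convex_cone_scaleR[OF cone])
  ultimately have "?x1 \<in> ray u" using face_ofD[OF u(2)] real_vec_in_ray by blast
  then obtain t where t: "?x1 = t *\<^sub>R real_vec u" by (rule rayE)
  have "real_vec u \<bullet> real_vec (b' j) = real_of_int (c j)" by (simp add: inner_real_vec c_def)
  hence "2 * real_of_int (c j) = t * real_of_int (c j)" using j1(1) unfolding t by simp
  hence "t = 2" using j by simp
  hence "real_vec (c j *s b j) = real_vec u" using t by simp
  hence eq: "u = c j *s b j" by (simp add: real_vec_simps(3))
  have "c j dvd Gcd (range (\<lambda>k. u $ k))" by (rule Gcd_greatest) (subst (asm) eq, auto)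
  hence "c j dvd 1" using u(1) by (simp add: primitive_vec_def)
  hence "c j = 1" using \<open>c j > 0\<close> by simp
  thus ?thesis using eq by auto
qed

text \<open>The ray generators in a smooth cone are distinct members of a basis of the lattice, and a linear
  functional can be prescribed freely on a basis. Geometrically, every line bundle is trivial on the
  affine chart of the cone.\<close>

lemma smooth_cone_interpolation:
  fixes v :: "'r::finite \<Rightarrow> int ^ 'n::finite"
  assumes fan: "fan \<Sigma>" and rays: "ray_generators v \<Sigma>" and smooth: "smooth_fan \<Sigma>" and \<sigma>: "\<sigma> \<in> \<Sigma>"
  obtains m where "\<And>i. ray (v i) \<subseteq> \<sigma> \<Longrightarrow> int_dot (v i) m = z i"
proof -
  obtain b :: "'n \<Rightarrow> int ^ 'n" and J where b: "int_basis UNIV b UNIV" "\<sigma> = convex_cone hull (real_vec ` b ` J)"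
    using smooth \<sigma> by (auto simp: smooth_fan_def)
  obtain b' where b': "\<And>x. x = lin_comb UNIV (\<lambda>k. int_dot x (b' k)) b"
    "\<And>k l. int_dot (b l) (b' k) = (if k = l then 1 else 0)" using dual_basis[OF b(1)] by blast
  have inj: "inj v"
  proof (rule injI)
    fix i j assume "v i = v j"
    thus "i = j" using rays by (auto simp: ray_generators_def bij_betw_def inj_on_def)
  qed
  \<comment> \<open>At basis vectors off the range of v the value of inv_into is arbitrary; only the b k = v i matter.\<close>
  define m where "m = lin_comb UNIV (\<lambda>k. z (inv_into UNIV v (b k))) b'"
  show ?thesis
  proof (rule that)
    fix i assume i: "ray (v i) \<subseteq> \<sigma>"
    have "ray (v i) \<in> \<Sigma>" using rays by (auto simp: ray_generators_def bij_betw_def)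
    hence "(ray (v i) \<inter> \<sigma>) face_of \<sigma>" using fan \<sigma> by (auto simp: fan_def)
    hence "ray (v i) face_of \<sigma>" using i by (simp add: Int_absorb2)
    moreover have "primitive_vec (v i)" using rays by (simp add: ray_generators_def)
    ultimately obtain j where j: "v i = b j" using ray_in_smooth_cone[OF b' b(2)] by blast
    have "int_dot (b j) m = z (inv_into UNIV v (b j))"
      by (simp add: m_def int_dot_lin_comb b'(2) if_distrib cong: if_cong)
    thus "int_dot (v i) m = z i" using inv_f_f[OF inj, of i] j by simp
  qed
qed

text \<open>The normal cone shrinks when the face grows, so the normal cone of a face is contained in that of
  any of its vertices.\<close>

lemma normal_fan_vertex:
  assumes P: "P = convex hull (real_vec ` V)" "finite V"
    and \<Sigma>: "\<Sigma> = {normal_cone P F | F. F face_of P \<and> F \<noteq> {}}" and \<sigma>: "\<sigma> \<in> \<Sigma>"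
  obtains p where "p \<in> V" "normal_cone P {real_vec p} \<in> \<Sigma>" "\<sigma> \<subseteq> normal_cone P {real_vec p}"
proof -
  obtain F where F: "\<sigma> = normal_cone P F" "F face_of P" "F \<noteq> {}" using \<sigma> \<Sigma> by auto
  have "compact P" "convex P"
    unfolding P(1) by (simp_all add: compact_convex_hull finite_imp_compact P(2))
  hence "compact F" "convex F"
    using F(2) face_of_imp_compact face_of_imp_convex by blast+
  then obtain x where x: "x extreme_point_of F" using extreme_point_exists_convex F(3) by blast
  hence xP: "x extreme_point_of P" "x \<in> F" using extreme_point_of_face[OF F(2)] by auto
  then obtain p where p: "p \<in> V" "x = real_vec p" using extreme_point_of_convex_hull P(1) by blast
  have "{x} face_of P" using xP(1) by (simp add: face_of_singleton)
  hence "normal_cone P {real_vec p} \<in> \<Sigma>" unfolding \<Sigma> p(2) by blast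
  moreover have "\<sigma> \<subseteq> normal_cone P {real_vec p}"
    using xP(2) by (auto simp: F(1) normal_cone_def p(2))
  ultimately show ?thesis using that p(1) by blast
qed

lemma normal_cone_iff:
  assumes P: "P = convex hull (real_vec ` V)" and p: "p \<in> V"
  shows "real_vec u \<in> normal_cone P {real_vec p} \<longleftrightarrow> (\<forall>q\<in>V. int_dot u p \<le> int_dot u q)"
proof
  assume u: "real_vec u \<in> normal_cone P {real_vec p}"
  show "\<forall>q\<in>V. int_dot u p \<le> int_dot u q"
  proof
    fix q assume "q \<in> V"
    hence "real_vec q \<in> P" unfolding P by (intro hull_inc) simp
    hence "real_vec u \<bullet> real_vec p \<le> real_vec u \<bullet> real_vec q" using u by (simp add: normal_cone_def)
    thus "int_dot u p \<le> int_dot u q" by (simp add: inner_real_vec)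
  qed
next
  assume "\<forall>q\<in>V. int_dot u p \<le> int_dot u q"
  hence "real_vec ` V \<subseteq> {x. real_vec u \<bullet> real_vec p \<le> real_vec u \<bullet> x}"
    by (auto simp: inner_real_vec)
  hence "P \<subseteq> {x. real_vec u \<bullet> real_vec p \<le> real_vec u \<bullet> x}"
    unfolding P by (intro hull_minimal convex_halfspace_ge)
  thus "real_vec u \<in> normal_cone P {real_vec p}" by (auto simp: normal_cone_def)
qed

lemma ray_subset_normal_cone_iff: "ray u \<subseteq> normal_cone P F \<longleftrightarrow> real_vec u \<in> normal_cone P F"
proof
  assume *: "real_vec u \<in> normal_cone P F"
  show "ray u \<subseteq> normal_cone P F"
  proof
    fix x assume "x \<in> ray u"
    then obtain t where "t \<ge> 0" "x = t *\<^sub>R real_vec u" by (rule rayE)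
    thus "x \<in> normal_cone P F" using * by (auto simp: normal_cone_def intro: mult_left_mono)
  qed
qed (use real_vec_in_ray in blast)

text \<open>The polytope defines the divisor whose coefficient at \<open>i\<close> is minus the minimum of \<open>v i\<close> on the polytope; \<open>a\<close> is
  its class. Translation by a vertex \<open>p\<close> makes the coefficients zero at the rays of the normal cone of
  \<open>p\<close> and positive at all others, and any \<open>e\<close> has a representative that is zero at the former rays.
  Hence \<open>k a + e\<close> is effective away from that cone for large \<open>k\<close>. As there are finitely many cones,
  one bound on \<open>k\<close> serves for all of them.\<close>

theorem ample_class:
  fixes v :: "'r::finite \<Rightarrow> int ^ 'n::finite" and \<beta> :: "int ^ 'r ^ 'd::finite"
  assumes rays: "ray_generators v \<Sigma>" and smooth: "smooth_fan \<Sigma>" and proj: "projective_fan \<Sigma>"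
    and exact: "short_exact (ray_matrix v) \<beta>"
  obtains a where "\<And>e. \<exists>k0. \<forall>k\<ge>k0. int k *s a + e \<in> nef_semigroup v \<Sigma> \<beta>"
proof -
  obtain V P where VP: "finite V" "P = convex hull (real_vec ` V)"
    and \<Sigma>: "\<Sigma> = {normal_cone P F | F. F face_of P \<and> F \<noteq> {}}" and fan: "fan \<Sigma>"
    using proj by (auto simp: projective_fan_def)
  have finite: "finite \<Sigma>" using fan by (simp add: fan_def)
  define h :: "int ^ 'r" where "h = (\<chi> i. Min ((\<lambda>q. int_dot (v i) q) ` V))"
  have h: "h $ i \<le> int_dot (v i) q" if "q \<in> V" for i q
    using VP(1) that by (simp add: h_def)
  have h_attained: "h $ i = int_dot (v i) p \<longleftrightarrow> (\<forall>q\<in>V. int_dot (v i) p \<le> int_dot (v i) q)" if "p \<in> V" for i p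
  proof
    show "\<forall>q\<in>V. int_dot (v i) p \<le> int_dot (v i) q" if "h $ i = int_dot (v i) p"
      using h that by metis
    show "h $ i = int_dot (v i) p" if "\<forall>q\<in>V. int_dot (v i) p \<le> int_dot (v i) q"
      using VP(1) that \<open>p \<in> V\<close> by (auto simp: h_def intro!: Min_eqI)
  qed
  have \<phi>: "\<beta> *v (ray_matrix v *v m) = 0" for m
    using exact by (auto simp: short_exact_def kernel_lattice_def)
  let ?a = "- (\<beta> *v h)"
  let ?N = "\<lambda>\<sigma>. {\<Sum>i | \<not> ray (v i) \<subseteq> \<sigma>. int (c i) *s column i \<beta> | c :: 'r \<Rightarrow> nat. True}"
  have local: "\<exists>k0. \<forall>k\<ge>k0. int k *s ?a + e \<in> ?N \<sigma>" if \<sigma>: "\<sigma> \<in> \<Sigma>" for \<sigma> e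
  proof -
    obtain p where p: "p \<in> V" "normal_cone P {real_vec p} \<in> \<Sigma>" "\<sigma> \<subseteq> normal_cone P {real_vec p}"
      using normal_fan_vertex[OF VP(2,1) \<Sigma> \<sigma>] by blast
    let ?\<sigma> = "normal_cone P {real_vec p}"
    obtain z where z: "e = \<beta> *v z" using exact unfolding short_exact_def surj_def by blast
    obtain m where m: "\<And>i. ray (v i) \<subseteq> ?\<sigma> \<Longrightarrow> int_dot (v i) m = z $ i"
      using smooth_cone_interpolation[OF fan rays smooth p(2)] by blast
    define y where "y = z - ray_matrix v *v m"
    have y: "y $ i = 0" if "ray (v i) \<subseteq> ?\<sigma>" for i
      using m[OF that] by (simp add: y_def ray_matrix_mult)
    define u where "u = ray_matrix v *v p - h"
    have u: "u $ i = int_dot (v i) p - h $ i" for i by (simp add: u_def ray_matrix_mult)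
    have u0: "u $ i = 0" if "ray (v i) \<subseteq> ?\<sigma>" for i
      using that h_attained[OF p(1), of i] normal_cone_iff[OF VP(2) p(1), of "v i"]
      by (simp add: u ray_subset_normal_cone_iff)
    have u1: "u $ i \<ge> 1" if "\<not> ray (v i) \<subseteq> ?\<sigma>" for i
      using that h[OF p(1), of i] h_attained[OF p(1), of i] normal_cone_iff[OF VP(2) p(1), of "v i"]
      by (auto simp: u ray_subset_normal_cone_iff)
    \<comment> \<open>As u is at least 1 where y may be negative, this multiple of u outweighs y.\<close>
    define k0 where "k0 = nat (\<Sum>i\<in>UNIV. \<bar>y $ i\<bar>)"
    have "int k *s ?a + e \<in> ?N \<sigma>" if k: "k \<ge> k0" for k
    proof -
      let ?w = "int k *s u + y"
      have w0: "?w $ i = 0" if "ray (v i) \<subseteq> \<sigma>" for i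
        using u0[of i] y[of i] that p(3) by auto
      have "?w $ i \<ge> 0" for i
      proof (cases "ray (v i) \<subseteq> ?\<sigma>")
        case False
        have "\<bar>y $ i\<bar> \<le> (\<Sum>i\<in>UNIV. \<bar>y $ i\<bar>)" by (rule member_le_sum) auto
        also have "\<dots> \<le> int k" using k by (simp add: k0_def)
        also have "\<dots> \<le> int k * u $ i" using u1[OF False] by (simp add: mult_le_cancel_left1)
        finally show ?thesis by simp
      qed (simp add: u0 y)
      hence w: "int (nat (?w $ i)) = ?w $ i" for i by simp
      have "\<beta> *v u = ?a"
        by (simp add: u_def matrix_vector_mult_diff_distrib \<phi>)
      moreover have "\<beta> *v (int k *s u) = int k *s (\<beta> *v u)"
        by (simp add: vec_eq_iff matrix_vector_mult_def sum_distrib_left algebra_simps)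
      moreover have "\<beta> *v y = e"
        by (simp add: z y_def matrix_vector_mult_diff_distrib \<phi>)
      ultimately have "int k *s ?a + e = \<beta> *v ?w"
        by (simp only: matrix_vector_right_distrib)
      also have "\<dots> = (\<Sum>i\<in>UNIV. ?w $ i *s column i \<beta>)" by (rule matrix_mult_sum)
      also have "\<dots> = (\<Sum>i | \<not> ray (v i) \<subseteq> \<sigma>. ?w $ i *s column i \<beta>)"
        by (rule sum.mono_neutral_right) (use w0 in auto)
      also have "\<dots> = (\<Sum>i | \<not> ray (v i) \<subseteq> \<sigma>. int (nat (?w $ i)) *s column i \<beta>)"
        by (simp only: w)
      finally show ?thesis by (intro CollectI exI[of _ "\<lambda>i. nat (?w $ i)"] conjI TrueI)
    qed
    thus ?thesis by blast
  qed
  show ?thesis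
  proof (rule that[of ?a])
    fix e
    have "\<forall>\<sigma>\<in>\<Sigma>. \<exists>k0. \<forall>n\<ge>k0. int n *s ?a + e \<in> ?N \<sigma>" using local by blast
    from bchoice[OF this] obtain k where
      k: "\<And>\<sigma> n. \<sigma> \<in> \<Sigma> \<Longrightarrow> n \<ge> k \<sigma> \<Longrightarrow> int n *s ?a + e \<in> ?N \<sigma>" by blast
    have "int n *s ?a + e \<in> nef_semigroup v \<Sigma> \<beta>" if "n \<ge> Max (insert 0 (k ` \<Sigma>))" for n
      unfolding nef_semigroup_def using that finite by (intro INT_I k) auto
    thus "\<exists>k0. \<forall>n\<ge>k0. int n *s ?a + e \<in> nef_semigroup v \<Sigma> \<beta>" by blast
  qed
qed

section \<open>The degree of a lattice ideal\<close>

lemma sublattice_kernel_lattice: "sublattice (kernel_lattice \<beta>)"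
  by (simp add: sublattice_def kernel_lattice_def matrix_vector_mult_diff_distrib)

lemma int_basis_columns:
  fixes \<phi> :: "int ^ 'n::finite ^ 'r::finite"
  assumes inj: "inj (\<lambda>y. \<phi> *v y)" and h: "bij_betw h J UNIV"
  shows "int_basis J (\<lambda>i. column (h i) \<phi>) (range (\<lambda>y. \<phi> *v y))"
proof -
  have image: "\<phi> *v y = lin_comb J (\<lambda>i. y $ h i) (\<lambda>i. column (h i) \<phi>)" for y
    unfolding matrix_mult_sum lin_comb_def
    by (rule sum.reindex_bij_betw[OF h, symmetric])
  have inv: "h (inv_into J h j) = j" "inv_into J h j \<in> J" for j
    using h by (auto simp: bij_betw_def f_inv_into_f inv_into_into)
  have inv': "inv_into J h (h i) = i" if "i \<in> J" for i
    using h that by (simp add: bij_betw_def)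
  have comb: "lin_comb J c (\<lambda>i. column (h i) \<phi>) = \<phi> *v (\<chi> j. c (inv_into J h j))" for c
    unfolding image by (rule lin_comb_cong) (simp_all add: inv')
  have "int_independent J (\<lambda>i. column (h i) \<phi>)"
    unfolding int_independent_def
  proof (intro allI impI ballI)
    fix c i assume "lin_comb J c (\<lambda>i. column (h i) \<phi>) = 0" and i: "i \<in> J"
    hence "\<phi> *v (\<chi> j. c (inv_into J h j)) = \<phi> *v 0" by (simp add: comb)
    hence "(\<chi> j. c (inv_into J h j)) = 0" by (rule injD[OF inj])
    hence "(\<chi> j. c (inv_into J h j)) $ h i = 0" by simp
    thus "c i = 0" by (simp add: inv'[OF i])
  qed
  moreover have "int_span J (\<lambda>i. column (h i) \<phi>) = range (\<lambda>y. \<phi> *v y)"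
  proof
    show "int_span J (\<lambda>i. column (h i) \<phi>) \<subseteq> range (\<lambda>y. \<phi> *v y)" by (auto simp: int_span_def comb)
    show "range (\<lambda>y. \<phi> *v y) \<subseteq> int_span J (\<lambda>i. column (h i) \<phi>)" by (auto simp: image)
  qed
  ultimately show ?thesis by (simp add: int_basis_iff)
qed

text \<open>Each single cone already witnesses that nef degrees are degrees of monomials.\<close>

lemma nef_degree_effective:
  fixes \<beta> :: "int ^ 'r::finite ^ 'd::finite"
  assumes "\<Sigma> \<noteq> {}" "\<alpha> \<in> nef_semigroup v \<Sigma> \<beta>"
  obtains w :: "int ^ 'r" where "\<And>i. 0 \<le> w $ i" "\<alpha> = \<beta> *v w"
proof -
  obtain \<sigma> where "\<sigma> \<in> \<Sigma>" using assms(1) by blast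
  then obtain c :: "'r \<Rightarrow> nat" where c: "\<alpha> = (\<Sum>i | \<not> ray (v i) \<subseteq> \<sigma>. int (c i) *s column i \<beta>)"
    using assms(2) by (auto simp: nef_semigroup_def)
  define w where "w = (\<chi> i. if ray (v i) \<subseteq> \<sigma> then 0 else int (c i))"
  have "\<alpha> = (\<Sum>i | \<not> ray (v i) \<subseteq> \<sigma>. w $ i *s column i \<beta>)"
    unfolding c by (rule sum.cong) (auto simp: w_def)
  also have "\<dots> = (\<Sum>i\<in>UNIV. w $ i *s column i \<beta>)"
    by (rule sum.mono_neutral_left) (auto simp: w_def)
  also have "\<dots> = \<beta> *v w" by (rule matrix_mult_sum[symmetric])
  finally show ?thesis using that[of w] by (simp add: w_def)
qed

text \<open>Choose an effective class \<open>\<gamma>\<close> represented by a vector so positive that it remains nonnegative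
  after adding each of finitely many coset representatives of the quotient. From \<open>\<gamma>\<close> on, every coset
  of \<open>L\<close> in the relevant fibre of \<open>\<beta>\<close> contains the exponent of a monomial.\<close>

lemma hilbert_function_eventually_index:
  fixes L :: "(int ^ 'r::finite) set" and \<beta> :: "int ^ 'r ^ 'd::finite"
  assumes L: "sublattice L" "L \<subseteq> kernel_lattice \<beta>"
    and fin: "finite (quotient_group (kernel_lattice \<beta>) L)" and "\<Sigma> \<noteq> {}"
  obtains \<gamma> where "\<And>\<alpha>. \<alpha> \<in> nef_semigroup v \<Sigma> \<beta> \<Longrightarrow>
    hilbert_function \<beta> (lattice_ideal L :: ('r, 'k::field) mpoly set) (\<gamma> + \<alpha>)
      = card (quotient_group (kernel_lattice \<beta>) L)"
proof -
  let ?M = "kernel_lattice \<beta>" let ?Q = "quotient_group ?M L"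
  have Q: "?Q = (\<lambda>x. x +o L) ` ?M" by (rule quotient_group_eq[OF L(1) sublattice_kernel_lattice L(2)])
  obtain R where R: "R \<subseteq> ?M" "finite R" "?Q = (\<lambda>x. x +o L) ` R"
    using finite_subset_image[OF fin, of "\<lambda>x. x +o L" ?M] Q by blast
  define u0 :: "int ^ 'r" where "u0 = (\<chi> i. \<Sum>x\<in>R. \<bar>x $ i\<bar>)"
  have u0: "0 \<le> u0 $ i + x $ i" if "x \<in> R" for x i
    using member_le_sum[OF that, of "\<lambda>x. \<bar>x $ i\<bar>"] R(2) by (simp add: u0_def)
  show ?thesis
  proof (rule that[of "\<beta> *v u0"])
    fix \<alpha> assume "\<alpha> \<in> nef_semigroup v \<Sigma> \<beta>"
    then obtain w :: "int ^ 'r" where w: "\<And>i. 0 \<le> w $ i" "\<alpha> = \<beta> *v w"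
      using nef_degree_effective[OF \<open>\<Sigma> \<noteq> {}\<close>] by blast
    let ?D = "{u. monomial_degree \<beta> u = \<beta> *v u0 + \<alpha>}"
    have "lattice_coset L ` ?D = (\<lambda>A. (u0 + w) +o A) ` ?Q"
    proof (intro equalityI image_subsetI)
      fix u assume "u \<in> ?D"
      hence "exponent_vector u - (u0 + w) \<in> ?M"
        by (simp add: monomial_degree_eq w(2) kernel_lattice_def matrix_vector_mult_diff_distrib
            matrix_vector_right_distrib)
      moreover have "lattice_coset L u = (u0 + w) +o ((exponent_vector u - (u0 + w)) +o L)"
        by (simp add: lattice_coset_def set_plus_rearrange2)
      ultimately show "lattice_coset L u \<in> (\<lambda>A. (u0 + w) +o A) ` ?Q" unfolding Q by blast
    next
      fix A assume "A \<in> ?Q"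
      then obtain x where x: "x \<in> R" "A = x +o L" unfolding R(3) by blast
      let ?u = "pos_part (u0 + w + x)"
      have u: "exponent_vector ?u = u0 + w + x"
      proof (rule exponent_vector_pos_part)
        show "0 \<le> (u0 + w + x) $ i" for i using u0[OF x(1), of i] w(1)[of i] by simp
      qed
      have "\<beta> *v x = 0" using x(1) R(1) by (auto simp: kernel_lattice_def)
      hence "?u \<in> ?D" by (simp add: monomial_degree_eq u w(2) matrix_vector_right_distrib)
      moreover have "(u0 + w) +o A = lattice_coset L ?u"
        by (simp add: lattice_coset_def u x(2) set_plus_rearrange2)
      ultimately show "(u0 + w) +o A \<in> lattice_coset L ` ?D" by blast
    qed
    moreover have "inj_on (\<lambda>A. (u0 + w) +o A) ?Q"
      by (rule inj_on_inverseI[of _ "\<lambda>A. (- (u0 + w)) +o A"])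
        (simp add: set_plus_rearrange2)
    ultimately have card: "card (lattice_coset L ` ?D) = card ?Q" and fin': "finite (lattice_coset L ` ?D)"
      using fin by (simp_all add: card_image)
    show "hilbert_function \<beta> (lattice_ideal L :: ('r, 'k) mpoly set) (\<beta> *v u0 + \<alpha>) = card ?Q"
      using hilbert_function_lattice_ideal[OF L fin'] card by simp
  qed
qed

theorem theorem6p3:
  fixes \<Sigma> :: "(real ^ 'n) set set"
    and v :: "'r::finite \<Rightarrow> int ^ 'n"
    and \<beta> :: "int ^ 'r ^ 'd"
    and L :: "(int ^ 'r) set"
    and I :: "('r, 'k::field) mpoly set"
  assumes "complete_fan \<Sigma>"
    and "simplicial_fan \<Sigma>"
    and "ray_generators v \<Sigma>"
    and "smooth_fan \<Sigma>"
    and "projective_fan \<Sigma>"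
    and "CARD('r) = CARD('n) + CARD('d)"
    and "short_exact (ray_matrix v) \<beta>"
    and "sublattice L"
    and "I = lattice_ideal L"
    and "homogeneous_ideal \<beta> I"
    and "krull_dim (cox_ring Quot I) = enat CARD('d)"
  shows "(\<exists>!P. is_hilbert_polynomial v \<Sigma> \<beta> I P)
    \<and> hilbert_polynomial v \<Sigma> \<beta> I = Poly_Mapping.single 0 (ideal_degree v \<Sigma> \<beta> I)
    \<and> finite (quotient_group (kernel_lattice \<beta>) L)
    \<and> ideal_degree v \<Sigma> \<beta> I = of_nat (card (quotient_group (kernel_lattice \<beta>) L))
    \<and> (\<exists>d. invariant_factors CARD('n) d (kernel_lattice \<beta>) L)
    \<and> (\<forall>d. invariant_factors CARD('n) d (kernel_lattice \<beta>) L \<longrightarrow>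
         card (quotient_group (kernel_lattice \<beta>) L) = (\<Prod>i=1..CARD('n). d i))"
proof -
  let ?M = "kernel_lattice \<beta>" and ?n = "CARD('n)"
  let ?Q = "quotient_group ?M L"
  have L: "sublattice L" "L \<subseteq> ?M"
    using assms(8) homogeneous_lattice_ideal_imp_subset[OF assms(8) assms(10)[unfolded assms(9)]] .
  have M: "sublattice ?M" by (rule sublattice_kernel_lattice)
  have range: "range (\<lambda>y. ray_matrix v *v y) = ?M" and inj: "inj (\<lambda>y. ray_matrix v *v y)"
    using assms(7) by (simp_all add: short_exact_def)
  have tors: "\<exists>k>0. k *s x \<in> L" if "x \<in> ?M" for x
    using torsion_of_krull_dim[OF L(1), of "ray_matrix v" x "CARD('d)"] L(2) that assms(6,9,11)
    unfolding range by blast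
  obtain h where h: "bij_betw h {1..?n} (UNIV :: 'n set)"
    using ex_bij_betw_nat_finite_1[of "UNIV :: 'n set"] by auto
  have "int_basis {1..?n} (\<lambda>i. column (h i) (ray_matrix v)) ?M"
    using int_basis_columns[OF inj h] unfolding range .
  from stacked_bases[OF this L tors] have ex: "\<exists>d. invariant_factors ?n d ?M L"
    unfolding invariant_factors_def by blast
  have card: "finite ?Q \<and> card ?Q = (\<Prod>i=1..?n. d i)" if inv: "invariant_factors ?n d ?M L" for d
  proof -
    obtain m where m: "int_basis {1..?n} m ?M" "int_basis {1..?n} (\<lambda>i. int (d i) *s m i) L"
      using inv unfolding invariant_factors_def by blast
    have d: "0 < d i" if "i \<in> {1..?n}" for i
      using inv that by (simp add: invariant_factors_def)
    show ?thesis using card_quotient_group[OF m d L(1) M L(2)] by blast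
  qed
  have fin: "finite ?Q" using ex card by blast
  have "\<Sigma> \<noteq> {}" using assms(1) by (auto simp: complete_fan_def)
  from hilbert_function_eventually_index[OF L fin this] obtain \<gamma> where
    \<gamma>: "\<And>\<alpha>. \<alpha> \<in> nef_semigroup v \<Sigma> \<beta> \<Longrightarrow> hilbert_function \<beta> I (\<gamma> + \<alpha>) = card ?Q"
    unfolding assms(9) by blast
  have hilb: "is_hilbert_polynomial v \<Sigma> \<beta> I (Poly_Mapping.single 0 (of_nat (card ?Q)))"
    unfolding is_hilbert_polynomial_def eval_mpoly_single by (intro exI[of _ \<gamma>]) (simp add: \<gamma>)
  obtain a where "\<And>e. \<exists>k0. \<forall>k\<ge>k0. int k *s a + e \<in> nef_semigroup v \<Sigma> \<beta>"
    using ample_class[OF assms(3,4,5,7)] by blast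
  note unique = hilbert_polynomial_unique[OF this _ hilb]
  have poly: "hilbert_polynomial v \<Sigma> \<beta> I = Poly_Mapping.single 0 (of_nat (card ?Q))"
    unfolding hilbert_polynomial_def using hilb unique by (rule the_equality)
  have deg: "ideal_degree v \<Sigma> \<beta> I = of_nat (card ?Q)"
    unfolding ideal_degree_def poly by (rule the_equality) (rule refl, rule sym, erule injD[OF inj_single])
  show ?thesis
  proof (intro conjI allI impI)
    show "\<exists>!P. is_hilbert_polynomial v \<Sigma> \<beta> I P" using hilb unique by (rule ex1I)
    show "card ?Q = (\<Prod>i=1..?n. d i)" if "invariant_factors ?n d ?M L" for d
      using card[OF that] by (rule conjunct2)
  qed (use poly deg fin ex in simp_all)
qed

end
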